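(* Let $n\in\mathbb{N}$, $n<\alpha<n+1$, and suppose $B$ is an $A^\alpha$-interpolating Blaschke product with zeros $\{z_j\}_{j\in\mathbb{N}}$. For $k\in\mathbb{N}$ let $\mathcal{J}_k:=\{f\in A^\alpha:\ fB^k\in A^\alpha\}$, and for $j\in\mathbb{N}$ let $d_j:=\inf\{|z_j-z_l|:\ l\in\mathbb{N}\setminus\{j\}\}$. (a) If $k$ is an integer with $n/2<k\le n$, then for every $f\in\mathcal{J}_k$ there is a constant $C>0$, independent of $j$, such that $$|f(z_j)|\le C\, d_j^{\alpha-k}(1-|z_j|)^k,\qquad j\in\mathbb{N}.$$ (b) For each $k=1,\dots,n$, there is a function $f\in\mathcal{J}_k$ with $$|f(z_j)|\asymp d_j^{\alpha-k}(1-|z_j|)^k,\qquad j\in\mathbb{N},$$ that is, the ratio of the two sides lies between two positive constants independent of $j$.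
   Context: Notation: $\mathbb{N}=\{1,2,\dots\}$, $\mathbb{D}=\{z\in\mathbb{C}:|z|<1\}$, $\mathbb{T}=\partial\mathbb{D}$; $H^\infty$ is the algebra of bounded analytic functions on $\mathbb{D}$. For $\alpha>0$, $A^\alpha$ is the set of all $f\in H^\infty$ such that $|f^{(m)}(z)|=O((1-|z|)^{\alpha-m})$, $z\in\mathbb{D}$, for some (equivalently, any) integer $m>\alpha$. If $n<\alpha<n+1$ with $n$ a nonnegative integer, then for $f\in A^\alpha$ the derivatives $f,f',\dots,f^{(n)}$ extend continuously to $\mathrm{clos}\,\mathbb{D}$, and their values on $\mathbb{T}$ are understood in this sense. Blaschke product: for a sequence $\{z_j\}\subset\mathbb{D}$ with $\sum_j(1-|z_j|)<\infty$, the Blaschke product with zeros $\{z_j\}$ is $B(z)=\prod_j\frac{\bar z_j}{|z_j|}\frac{z_j-z}{1-\bar z_jz}$ (with the factor interpreted as $z$ if $z_j=0$). $A^\alpha$-interpolating sets (for $n<\alpha<n+1$, $n$ a nonnegative integer): a closed set $E\subset\mathrm{clos}\,\mathbb{D}$ is an $A^\alpha$-interpolating set if, for all functions $\varphi_0,\dots,\varphi_n:E\to\mathbb{C}$ satisfying, with some constant $C>0$, $$\left|\varphi_s(z)-\sum_{m=0}^{n-s}\frac{\varphi_{s+m}(w)}{m!}(z-w)^m\right|\le C|z-w|^{\alpha-s}\qquad(z,w\in E,\ s=0,\dots,n),$$ there exists $g\in A^\alpha$ with $g|_E=\varphi_0,\ g'|_E=\varphi_1,\ \dots,\ g^{(n)}|_E=\varphi_n$.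 A Blaschke product $B$ with zeros $\{z_j\}$ is an $A^\alpha$-interpolating Blaschke product if its zeros $z_j$ are all simple (so the $z_j$ are pairwise distinct) and $\mathrm{clos}\{z_j\}$ is an $A^\alpha$-interpolating set. *)

theory Defs
  imports "HOL-Complex_Analysis.Complex_Analysis"
begin

text \<open>
  Functions on the unit disc are total functions of type \<^typ>\<open>complex \<Rightarrow> complex\<close> of which only the
  values on \<^term>\<open>ball (0::complex) 1\<close> matter; since the disc is open, this includes the values
  of the iterated derivatives \<^term>\<open>(deriv ^^ m) f\<close> there.
\<close>

definition A_space :: "real \<Rightarrow> (complex \<Rightarrow> complex) set" where
  "A_space \<alpha> = {f. f holomorphic_on ball 0 1 \<and> bounded (f ` ball 0 1) \<and>
     (\<exists>m::nat. real m > \<alpha> \<and>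
       (\<exists>C. \<forall>z\<in>ball 0 1. norm ((deriv ^^ m) f z) \<le> C * (1 - norm z) powr (\<alpha> - real m)))}"

definition extends_to_closed_disc :: "(complex \<Rightarrow> complex) \<Rightarrow> (complex \<Rightarrow> complex) \<Rightarrow> bool" where
  "extends_to_closed_disc h G \<longleftrightarrow>
     continuous_on (cball 0 1) G \<and> (\<forall>z\<in>ball 0 1. G z = h z)"

text \<open>
  The interpolation data \<open>\<phi>\<^sub>0, \<dots>, \<phi>\<^sub>n\<close> are \<open>\<phi> 0, \<dots>, \<phi> n\<close>, and only their values on \<open>E\<close> matter.
  For \<open>z = w\<close> the condition reads \<open>0 \<le> 0\<close>, by \<open>0 ^ 0 = 1\<close> and \<open>0 powr a = 0\<close>.
\<close>

definition jet_condition ::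
  "nat \<Rightarrow> real \<Rightarrow> complex set \<Rightarrow> (nat \<Rightarrow> complex \<Rightarrow> complex) \<Rightarrow> bool" where
  "jet_condition n \<alpha> E \<phi> \<longleftrightarrow>
     (\<exists>C>0. \<forall>z\<in>E. \<forall>w\<in>E. \<forall>s\<le>n.
        norm (\<phi> s z - (\<Sum>m=0..n-s. \<phi> (s + m) w / fact m * (z - w) ^ m))
          \<le> C * norm (z - w) powr (\<alpha> - real s))"

text \<open>
  Meant for \<open>n < \<alpha> < n + 1\<close>. On the unit circle, the derivatives of \<open>g\<close> of order at most \<open>n\<close> are
  given by their (necessarily unique) continuous extensions to the closed disc.
\<close>

definition A_interpolating_set :: "nat \<Rightarrow> real \<Rightarrow> complex set \<Rightarrow> bool" where
  "A_interpolating_set n \<alpha> E \<longleftrightarrow> closed E \<and> E \<subseteq> cball 0 1 \<and>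
     (\<forall>\<phi>. jet_condition n \<alpha> E \<phi> \<longrightarrow>
        (\<exists>g\<in>A_space \<alpha>. \<forall>s\<le>n. \<exists>G.
           extends_to_closed_disc ((deriv ^^ s) g) G \<and> (\<forall>z\<in>E. G z = \<phi> s z)))"

definition blaschke_seq :: "(nat \<Rightarrow> complex) \<Rightarrow> bool" where
  "blaschke_seq z \<longleftrightarrow> (\<forall>j. norm (z j) < 1) \<and> summable (\<lambda>j. 1 - norm (z j))"

definition blaschke_factor :: "complex \<Rightarrow> complex \<Rightarrow> complex" where
  "blaschke_factor a w =
     (if a = 0 then w else cnj a / of_real (norm a) * ((a - w) / (1 - cnj a * w)))"

definition blaschke_product :: "(nat \<Rightarrow> complex) \<Rightarrow> complex \<Rightarrow> complex" where
  "blaschke_product z w = (\<Prod>j. blaschke_factor (z j) w)"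

text \<open>The zeros of the Blaschke product are all simple iff the sequence \<open>z\<close> is injective.\<close>

definition A_interpolating_blaschke :: "nat \<Rightarrow> real \<Rightarrow> (nat \<Rightarrow> complex) \<Rightarrow> bool" where
  "A_interpolating_blaschke n \<alpha> z \<longleftrightarrow>
     blaschke_seq z \<and> inj z \<and> A_interpolating_set n \<alpha> (closure (range z))"

definition J_space :: "real \<Rightarrow> (complex \<Rightarrow> complex) \<Rightarrow> nat \<Rightarrow> (complex \<Rightarrow> complex) set" where
  "J_space \<alpha> B k = {f \<in> A_space \<alpha>. (\<lambda>w. f w * B w ^ k) \<in> A_space \<alpha>}"

definition sep_dist :: "(nat \<Rightarrow> complex) \<Rightarrow> nat \<Rightarrow> real" where
  "sep_dist z j = (INF l\<in>UNIV - {j}. norm (z j - z l))"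

end

theory Submission imports Defs begin

text \<open>
  The data with values \<open>0\<close> or \<open>d\<^sub>j\<^sup>\<alpha>\<close> at the zeros and vanishing derivatives satisfy the jet condition.
  Interpolating all of them yields, by a Baire category argument, functions of uniformly bounded norm
  that live at a single zero; these force \<open>d\<^sub>j \<ge> c (1 - |z\<^sub>j|)\<close> and uniform separation, hence
  \<open>|B'(z\<^sub>j)| \<asymp> 1 / (1 - |z\<^sub>j|)\<close>.

  For (a), \<open>g = f B\<^sup>k\<close> vanishes to order \<open>k\<close> at \<open>z\<^sub>j\<close> and at a nearest zero \<open>z\<^sub>l\<close>. Expanding the first
  \<open>n - k + 1 \<le> k\<close> jets at \<open>z\<^sub>l\<close> around \<open>z\<^sub>j\<close> gives enough linear relations to isolate \<open>g\<^sup>(\<^sup>k\<^sup>)(z\<^sub>j)\<close>, of size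
  \<open>O(d\<^sub>j\<^sup>\<alpha>\<^sup>-\<^sup>k)\<close>, which is \<open>k! f(z\<^sub>j) B'(z\<^sub>j)\<^sup>k\<close>. For (b), interpolate \<open>h\<^sup>(\<^sup>k\<^sup>)(z\<^sub>j) = d\<^sub>j\<^sup>\<alpha>\<^sup>-\<^sup>k\<close> with all other jets zero and
  put \<open>f = h / B\<^sup>k\<close>, which stays in the class because division by inner functions does.
\<close>

section \<open>Growth bounds and Taylor estimates\<close>

text \<open>Interpolating sets are defined by mere solvability, while both estimates need constants
  uniform in \<open>j\<close>; that gap is the main obstacle. It closes because the jet condition
  for the data 0 or \<open>d_j ^ \<alpha>\<close> holds with the same constant 2 for every choice of
  the zeros carrying a value: every 0/1 pattern is solvable, and interpolants of two patterns that
  differ only at \<open>j\<close> subtract to a function living at \<open>z j\<close>.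
  \<open>A_bound\<close> therefore keeps order and constant explicit, in a form that survives
  locally uniform limits. Quotients by Blaschke products are estimated for finite products, with
  constants that see neither the number nor the position of the zeros; normal families carry the
  estimates over to \<open>B\<close>. In (a) the condition k > n/2 is a count: the unknowns are the
  derivatives of \<open>g\<close> of orders k, ..., n at \<open>z j\<close>, and the matching n - k
  + 1 relations use the orders 0, ..., n - k at the neighbouring zero, which are known to vanish as
  soon as n - k < k.\<close>

definition A_bound :: "nat \<Rightarrow> real \<Rightarrow> real \<Rightarrow> (complex \<Rightarrow> complex) \<Rightarrow> bool" where
  "A_bound m \<alpha> M g \<longleftrightarrow> g holomorphic_on ball 0 1 \<and>
     (\<forall>z\<in>ball 0 1. norm (g z) \<le> M \<and> norm ((deriv ^^ m) g z) \<le> M * (1 - norm z) powr (\<alpha> - real m))"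

lemma A_boundD:
  assumes "A_bound m \<alpha> M g"
  shows "g holomorphic_on ball 0 1" "\<And>z. norm z < 1 \<Longrightarrow> norm (g z) \<le> M"
    "\<And>z. norm z < 1 \<Longrightarrow> norm ((deriv ^^ m) g z) \<le> M * (1 - norm z) powr (\<alpha> - real m)" "0 \<le> M"
  using assms norm_ge_zero[of "g 0"] unfolding A_bound_def
  by (auto intro: order_trans[OF norm_ge_zero[of "g 0"]])

lemma A_bound_mono:
  assumes "A_bound m \<alpha> M g" "M \<le> M'"
  shows "A_bound m \<alpha> M' g"
proof -
  have "M * (1 - norm z) powr (\<alpha> - real m) \<le> M' * (1 - norm z) powr (\<alpha> - real m)" for z :: complex
    using assms(2) by (intro mult_right_mono) auto
  then show ?thesis
    using assms unfolding A_bound_def by (meson order_trans)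
qed

lemma A_space_iff_A_bound: "g \<in> A_space \<alpha> \<longleftrightarrow> (\<exists>m M. real m > \<alpha> \<and> A_bound m \<alpha> M g)"
proof
  assume "g \<in> A_space \<alpha>"
  then obtain m C b where m: "real m > \<alpha>" "g holomorphic_on ball 0 1"
      and C: "\<And>z. z \<in> ball 0 1 \<Longrightarrow> norm ((deriv ^^ m) g z) \<le> C * (1 - norm z) powr (\<alpha> - real m)"
      and b: "\<And>z. z \<in> ball 0 1 \<Longrightarrow> norm (g z) \<le> b"
    unfolding A_space_def bounded_iff by fastforce
  have "C * (1 - norm z) powr (\<alpha> - real m) \<le> max b C * (1 - norm z) powr (\<alpha> - real m)" for z :: complex
    by (intro mult_right_mono) auto
  then have "A_bound m \<alpha> (max b C) g"
    unfolding A_bound_def using m(2) C b by (meson max.coboundedI1 order_trans)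
  with m(1) show "\<exists>m M. real m > \<alpha> \<and> A_bound m \<alpha> M g" by blast
next
  assume "\<exists>m M. real m > \<alpha> \<and> A_bound m \<alpha> M g"
  then show "g \<in> A_space \<alpha>"
    unfolding A_space_def A_bound_def bounded_iff by blast
qed

text \<open>A mean value inequality with an antiderivative in place of a constant: the bounds on
  derivatives blow up at the circle and have to be integrated. At the end points
  \<open>\<psi>\<close> is merely continuous, which covers (1 - t) powr \<beta> at t = 1.\<close>

lemma ray_bound:
  fixes G :: "complex \<Rightarrow> complex"
  assumes G: "G holomorphic_on ball 0 1" and z: "norm z < 1"
    and ab: "0 \<le> a" "a < b" "b \<le> 1" and cont: "continuous_on {a..b} \<psi>"
    and \<psi>: "\<And>t. a < t \<Longrightarrow> t < b \<Longrightarrow> (\<psi> has_real_derivative \<psi>' t) (at t)"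
    and le: "\<And>t. a < t \<Longrightarrow> t < b \<Longrightarrow> norm (deriv G (of_real t * z)) * norm z \<le> \<psi>' t"
  shows "norm (G (of_real b * z) - G (of_real a * z)) \<le> \<psi> b - \<psi> a"
proof (rule differentiable_bound_general[OF \<open>a < b\<close>])
  have in_ball: "of_real t * z \<in> ball 0 1" if "a \<le> t" "t \<le> b" for t
  proof -
    have "t * norm z \<le> norm z" using that ab by (intro mult_left_le_one_le) auto
    then show ?thesis using that ab z by (auto simp: norm_mult)
  qed
  show "continuous_on {a..b} (\<lambda>t. G (of_real t * z))"
    by (rule continuous_on_compose2[OF holomorphic_on_imp_continuous_on[OF G]])
       (use in_ball in \<open>auto intro!: continuous_intros\<close>)
  show "((\<lambda>t. G (of_real t * z)) has_vector_derivative (z * deriv G (of_real t * z))) (at t)"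
    if "a < t" "t < b" for t
  proof -
    have d: "(G has_field_derivative deriv G (of_real t * z)) (at (of_real t * z))"
      using G in_ball[of t] that by (simp add: holomorphic_derivI)
    have "((\<lambda>t. of_real t * z) has_vector_derivative z) (at t)"
      by (auto intro!: derivative_eq_intros simp: has_vector_derivative_def scaleR_conv_of_real)
    from field_vector_diff_chain_at[OF this d] show ?thesis by (simp add: o_def)
  qed
  show "(\<psi> has_vector_derivative \<psi>' t) (at t)" if "a < t" "t < b" for t
    using \<psi>[OF that] by (simp add: has_real_derivative_iff_has_vector_derivative)
  show "norm (z * deriv G (of_real t * z)) \<le> \<psi>' t" if "a < t" "t < b" for t
    using le[OF that] by (simp add: norm_mult mult.commute)
qed (fact cont)

text \<open>Integrating (1 - t) powr (- c - 1) along a ray gives (1 - t) powr (- c) / c since c > 0,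
  and the value at 0 is absorbed because (1 - |z|) powr (- c) is at least 1.\<close>

lemma A_bound_Suc_imp:
  assumes g: "A_bound (Suc m) \<alpha> M g" and "\<alpha> < real m"
  shows "\<exists>M'. A_bound m \<alpha> M' g"
proof -
  note D = A_boundD[OF g]
  define G where "G = (deriv ^^ m) g"
  define c where "c = real m - \<alpha>"
  have c: "c > 0" using assms by (simp add: c_def)
  have G: "G holomorphic_on ball 0 1" unfolding G_def using D(1) by (simp add: holomorphic_higher_deriv)
  have *: "norm (G z) \<le> (norm (G 0) + M / c) * (1 - norm z) powr (- c)" if z: "norm z < 1" for z
  proof -
    have pos: "1 - t * norm z > 0" if "0 \<le> t" "t \<le> 1" for t
      using mult_left_le_one_le[of "norm z" t] that z by simp
    have "norm (G (of_real 1 * z) - G (of_real 0 * z))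
        \<le> M / c * (1 - 1 * norm z) powr (- c) - M / c * (1 - 0 * norm z) powr (- c)"
    proof (rule ray_bound[OF G z, where \<psi>' = "\<lambda>t. M * (1 - t * norm z) powr (- c - 1) * norm z"])
      show "continuous_on {0..1} (\<lambda>t. M / c * (1 - t * norm z) powr (- c))"
        using pos by (intro continuous_intros) force+
      show "((\<lambda>t. M / c * (1 - t * norm z) powr (- c)) has_real_derivative
          M * (1 - t * norm z) powr (- c - 1) * norm z) (at t)" if "0 < t" "t < 1" for t
        using pos[of t] that c by (auto intro!: derivative_eq_intros simp: field_simps)
      fix t :: real assume t: "0 < t" "t < 1"
      have "norm (deriv G (of_real t * z)) \<le> M * (1 - t * norm z) powr (- c - 1)"
        using D(3)[of "of_real t * z"] t pos[of t] by (simp add: G_def c_def norm_mult algebra_simps)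
      then show "norm (deriv G (of_real t * z)) * norm z \<le> M * (1 - t * norm z) powr (- c - 1) * norm z"
        by (rule mult_right_mono) auto
    qed auto
    then have "norm (G z) \<le> norm (G 0) + M / c * (1 - norm z) powr (- c)"
      using norm_triangle_ineq2[of "G z" "G 0"] c D(4) by simp (smt (verit) divide_nonneg_nonneg)
    moreover have "norm (G 0) * 1 \<le> norm (G 0) * (1 - norm z) powr (- c)"
      using powr_mono2'[of "- c" "1 - norm z" 1] z c by (intro mult_left_mono) auto
    ultimately show ?thesis by (simp add: distrib_right)
  qed
  have "A_bound m \<alpha> (max M (norm (G 0) + M / c)) g"
    unfolding A_bound_def
  proof (intro conjI ballI)
    fix z :: complex assume z: "z \<in> ball 0 1"
    have "(norm (G 0) + M / c) * (1 - norm z) powr (- c)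
        \<le> max M (norm (G 0) + M / c) * (1 - norm z) powr (- c)"
      by (intro mult_right_mono) auto
    from order_trans[OF * this] z
    show "norm ((deriv ^^ m) g z) \<le> max M (norm (G 0) + M / c) * (1 - norm z) powr (\<alpha> - real m)"
      by (simp add: G_def c_def)
  qed (use D in \<open>auto intro: max.coboundedI1\<close>)
  then show ?thesis by blast
qed

text \<open>Downward half of the independence of the order: the hypotheses single out
  \<open>m\<close> as the least integer above \<open>\<alpha>\<close>, reached from the unknown
  order by repeated radial integration.\<close>

lemma A_space_imp_A_bound:
  assumes "g \<in> A_space \<alpha>" "\<alpha> < real m" "real m < \<alpha> + 1"
  shows "\<exists>M. A_bound m \<alpha> M g"
proof -
  obtain p M where p: "real p > \<alpha>" "A_bound p \<alpha> M g"
    using assms(1) A_space_iff_A_bound by blast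
  have "m \<le> p" using p assms by linarith
  then show ?thesis using p(2)
  proof (induction p arbitrary: M rule: dec_induct)
    case (step q)
    then show ?case using A_bound_Suc_imp[of q \<alpha> M g] assms(2) by (meson of_nat_le_iff less_le_trans)
  qed auto
qed

text \<open>The Hardy-Littlewood argument: move both points inward by \<delta>, cross at that level,
  and move out again. The radial legs cost M / \<beta> each and the crossing M, all times \<delta>
  powr \<beta>; hence the constant.\<close>

lemma hoelder_of_deriv_bound:
  fixes G :: "complex \<Rightarrow> complex"
  assumes G: "G holomorphic_on ball 0 1" and \<beta>: "0 < \<beta>" "\<beta> < 1" and M: "0 \<le> M"
    and dG: "\<And>z. norm z < 1 \<Longrightarrow> norm (deriv G z) \<le> M * (1 - norm z) powr (\<beta> - 1)"
    and vw: "norm v < 1" "norm w < 1"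
  shows "norm (G w - G v) \<le> (2 / \<beta> + 1) * M * norm (w - v) powr \<beta>"
proof (cases "w = v")
  case False
  \<comment> \<open>Points of the disc may be almost 2 apart; capping at 1 keeps the radius 1 -
    \<delta> nonnegative, and for \<delta> = 1 both inner points are the origin.\<close>
  define \<delta> where "\<delta> = min 1 (norm (w - v))"
  have \<delta>: "0 < \<delta>" "\<delta> \<le> 1" "\<delta> \<le> norm (w - v)" using False by (auto simp: \<delta>_def)
  have \<delta>p: "\<delta> powr \<beta> \<le> norm (w - v) powr \<beta>" using \<delta> \<beta> by (intro powr_mono2) auto
  have rad: "norm (G z - G (of_real (1 - \<delta>) * z)) \<le> M / \<beta> * \<delta> powr \<beta>" if z: "norm z < 1" for z
  proof -
    have "norm (G (of_real 1 * z) - G (of_real (1 - \<delta>) * z))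
        \<le> (- M / \<beta> * (1 - 1) powr \<beta>) - (- M / \<beta> * (1 - (1 - \<delta>)) powr \<beta>)"
    proof (rule ray_bound[OF G z, where \<psi>' = "\<lambda>t. M * (1 - t) powr (\<beta> - 1)"])
      show "continuous_on {1 - \<delta>..1} (\<lambda>t. - M / \<beta> * (1 - t) powr \<beta>)"
        using \<beta> by (intro continuous_intros continuous_on_powr') auto
      fix t assume t: "1 - \<delta> < t" "t < 1"
      show "((\<lambda>t. - M / \<beta> * (1 - t) powr \<beta>) has_real_derivative M * (1 - t) powr (\<beta> - 1)) (at t)"
        using t \<beta> by (auto intro!: derivative_eq_intros simp: field_simps)
      have t0: "0 < t" using t \<delta> by linarith
      have le: "t * norm z \<le> t" using t0 z by (intro mult_left_le) auto
      have "norm (deriv G (of_real t * z)) \<le> M * (1 - t * norm z) powr (\<beta> - 1)"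
        using dG[of "of_real t * z"] le t t0 by (simp add: norm_mult)
      \<comment> \<open>Replacing t |z| by t makes the majorant independent of z and still
        integrable up to t = 1, as \<beta> > 0.\<close>
      also have "\<dots> \<le> M * (1 - t) powr (\<beta> - 1)"
        using le t \<beta> M powr_mono2'[of "\<beta> - 1" "1 - t" "1 - t * norm z"] by (intro mult_left_mono) auto
      finally have "norm (deriv G (of_real t * z)) \<le> M * (1 - t) powr (\<beta> - 1)" .
      then have "norm (deriv G (of_real t * z)) * norm z \<le> M * (1 - t) powr (\<beta> - 1) * 1"
        using z M by (intro mult_mono) auto
      then show "norm (deriv G (of_real t * z)) * norm z \<le> M * (1 - t) powr (\<beta> - 1)" by simp
    qed (use \<delta> in auto)
    then show ?thesis by simp
  qed
  define v' w' where "v' = of_real (1 - \<delta>) * v" and "w' = of_real (1 - \<delta>) * w"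
  have "norm (G w' - G v') \<le> M * \<delta> powr (\<beta> - 1) * norm (w' - v')"
  proof (rule field_differentiable_bound[where S = "cball 0 (1 - \<delta>)" and f' = "deriv G"])
    fix u :: complex assume u: "u \<in> cball 0 (1 - \<delta>)"
    then have u1: "norm u < 1" using \<delta> by auto
    show "(G has_field_derivative deriv G u) (at u within cball 0 (1 - \<delta>))"
      using G u1 by (auto intro: holomorphic_derivI[of _ "ball 0 1"])
    have "(1 - norm u) powr (\<beta> - 1) \<le> \<delta> powr (\<beta> - 1)"
      using u u1 \<beta> \<delta> powr_mono2'[of "\<beta> - 1" \<delta> "1 - norm u"] by auto
    then show "norm (deriv G u) \<le> M * \<delta> powr (\<beta> - 1)"
      using dG[OF u1] M by (meson mult_left_mono order_trans)
  next
    show "w' \<in> cball 0 (1 - \<delta>)" "v' \<in> cball 0 (1 - \<delta>)"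
      using vw \<delta> by (auto simp: v'_def w'_def norm_mult simp del: of_real_diff intro!: mult_left_le)
  qed auto
  also have "norm (w' - v') \<le> \<delta>"
  proof (cases "\<delta> = 1")
    case False
    then have "\<delta> = norm (w - v)" by (auto simp: \<delta>_def min_def split: if_splits)
    moreover have "norm (w' - v') = (1 - \<delta>) * norm (w - v)"
    proof -
      have "w' - v' = of_real (1 - \<delta>) * (w - v)" by (simp add: v'_def w'_def algebra_simps)
      then show ?thesis using \<delta> by (simp only: norm_mult norm_of_real)
    qed
    ultimately show ?thesis using \<delta> by (simp add: mult_left_le_one_le)
  qed (auto simp: v'_def w'_def)
  then have "M * \<delta> powr (\<beta> - 1) * norm (w' - v') \<le> M * \<delta> powr (\<beta> - 1) * \<delta>"
    using M by (intro mult_left_mono) auto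
  also have "\<dots> = M * \<delta> powr \<beta>" using \<delta> by (simp add: powr_diff)
  finally have mid: "norm (G w' - G v') \<le> M * \<delta> powr \<beta>" .
  have "G w - G v = (G w - G w') + (G w' - G v') - (G v - G v')" by simp
  then have "norm (G w - G v) \<le> norm (G w - G w') + norm (G w' - G v') + norm (G v - G v')"
    by (metis norm_triangle_ineq norm_triangle_ineq4 order_trans add_right_mono)
  also have "\<dots> \<le> M / \<beta> * \<delta> powr \<beta> + M * \<delta> powr \<beta> + M / \<beta> * \<delta> powr \<beta>"
    using rad[OF vw(1)] rad[OF vw(2)] mid by (simp add: v'_def w'_def)
  also have "\<dots> = (2 / \<beta> + 1) * M * \<delta> powr \<beta>" by (simp add: algebra_simps)
  also have "\<dots> \<le> (2 / \<beta> + 1) * M * norm (w - v) powr \<beta>"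
    using \<delta>p M \<beta> by (intro mult_left_mono) auto
  finally show ?thesis .
qed (use \<beta> M in auto)

text \<open>Downward induction on \<open>s\<close>: the remainder for \<open>s\<close> vanishes at
  \<open>v\<close>, and its derivative in \<open>w\<close> is the remainder for s + 1. The Hoelder
  estimate starts it at s = n, and integrating along a segment does not enlarge the
  constant.\<close>

lemma A_bound_taylor:
  assumes n: "real n < \<alpha>" "\<alpha> < real n + 1" and g: "A_bound (Suc n) \<alpha> M g"
    and vw: "norm v < 1" "norm w < 1" and s: "s \<le> n"
  shows "norm ((deriv ^^ s) g w - (\<Sum>m=0..n-s. (deriv ^^ (s + m)) g v / fact m * (w - v) ^ m))
      \<le> (2 / (\<alpha> - real n) + 1) * M * norm (w - v) powr (\<alpha> - real s)"
  using s vw(2)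
proof (induction s arbitrary: w rule: inc_induct)
  case base
  have "norm ((deriv ^^ n) g w - (deriv ^^ n) g v) \<le> (2 / (\<alpha> - real n) + 1) * M * norm (w - v) powr (\<alpha> - real n)"
    using A_boundD[OF g] n vw base
    by (intro hoelder_of_deriv_bound) (auto intro!: holomorphic_higher_deriv simp: algebra_simps)
  then show ?case by simp
next
  case (step s)
  note D = A_boundD[OF g]
  define K where "K = (2 / (\<alpha> - real n) + 1) * M"
  have K: "K \<ge> 0" using D(4) n by (auto simp: K_def)
  define R where "R = (\<lambda>w. (deriv ^^ s) g w - (\<Sum>m=0..n-s. (deriv ^^ (s + m)) g v / fact m * (w - v) ^ m))"
  define R' where "R' = (\<lambda>w. (deriv ^^ Suc s) g w - (\<Sum>m=0..n-Suc s. (deriv ^^ (Suc s + m)) g v / fact m * (w - v) ^ m))"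
  have ns: "n - s = Suc (n - Suc s)" using step by simp
  have R': "(R has_field_derivative R' u) (at u within S)" if "norm u < 1" for u S
  proof -
    have "((deriv ^^ s) g has_field_derivative (deriv ^^ Suc s) g u) (at u within S)"
      using D(1) that by (auto intro!: holomorphic_derivI[of _ "ball 0 1"] holomorphic_higher_deriv)
    moreover have "((\<lambda>w. \<Sum>m=0..n-s. (deriv ^^ (s + m)) g v / fact m * (w - v) ^ m) has_field_derivative
       (\<Sum>m=0..n-Suc s. (deriv ^^ (Suc s + m)) g v / fact m * (u - v) ^ m)) (at u within S)"
    proof -
      have 1: "(\<Sum>m=0..n-s. (deriv ^^ (s + m)) g v / fact m * (w - v) ^ m)
        = (deriv ^^ s) g v + (\<Sum>m=0..n-Suc s. (deriv ^^ (Suc s + m)) g v / fact (Suc m) * (w - v) ^ Suc m)" for w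
        unfolding ns by (subst sum.atLeast0_atMost_Suc_shift) (simp add: o_def)
      have *: "of_nat (Suc m) * c / (fact (Suc m) :: complex) = c / fact m" for m c
        by (simp add: divide_simps) (metis of_nat_Suc of_nat_eq_0_iff nat.distinct(1))
      show ?thesis unfolding 1
        by (auto intro!: derivative_eq_intros sum.cong simp del: power_Suc fact_Suc of_nat_Suc
              simp: * mult.assoc mult.left_commute)
    qed
    ultimately show ?thesis unfolding R_def R'_def by (rule DERIV_diff)
  qed
  have seg: "norm u < 1 \<and> norm (u - v) \<le> norm (w - v)" if "u \<in> closed_segment v w" for u
  proof
    have "closed_segment v w \<subseteq> ball 0 1" using vw step.prems by (intro closed_segment_subset) auto
    then show "norm u < 1" using that by auto
    show "norm (u - v) \<le> norm (w - v)"
      using that by (metis dist_in_closed_segment(1) dist_commute dist_norm)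
  qed
  have "norm (R w - R v) \<le> K * norm (w - v) powr (\<alpha> - real (Suc s)) * norm (w - v)"
  proof (rule field_differentiable_bound[where S = "closed_segment v w" and f' = R'])
    fix u assume u: "u \<in> closed_segment v w"
    show "(R has_field_derivative R' u) (at u within closed_segment v w)" using seg[OF u] R' by blast
    have "norm (R' u) \<le> K * norm (u - v) powr (\<alpha> - real (Suc s))"
      using step.IH[of u] seg[OF u] unfolding R'_def K_def by blast
    also have "\<dots> \<le> K * norm (w - v) powr (\<alpha> - real (Suc s))"
      using seg[OF u] K n step by (intro mult_left_mono powr_mono2) auto
    finally show "norm (R' u) \<le> K * norm (w - v) powr (\<alpha> - real (Suc s))" .
  qed auto
  also have "R v = 0" unfolding R_def
    by (subst sum.atLeast_Suc_atMost) (auto intro!: sum.neutral)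
  also have "K * norm (w - v) powr (\<alpha> - real (Suc s)) * norm (w - v) = K * norm (w - v) powr (\<alpha> - real s)"
    using powr_add[of "norm (w - v)" "\<alpha> - real (Suc s)" 1] by (cases "w = v") auto
  finally show ?case unfolding R_def K_def by simp
qed

text \<open>Montel's theorem, plus the fact that pointwise bounds pass to limits of derivatives: the
  same \<open>M\<close> serves for the limit, which keeps all later limiting arguments
  quantitative.\<close>

lemma A_bound_convergent_subseq:
  assumes "\<And>i. A_bound m \<alpha> M (g i)"
  obtains h r where "A_bound m \<alpha> M h" "strict_mono (r :: nat \<Rightarrow> nat)"
    "\<And>s w. norm w < 1 \<Longrightarrow> (\<lambda>i. (deriv ^^ s) (g (r i)) w) \<longlonglongrightarrow> (deriv ^^ s) h w"
proof -
  note D = A_boundD[OF assms]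
  obtain h r where h: "h holomorphic_on ball 0 1" "strict_mono (r :: nat \<Rightarrow> nat)"
      and lim: "\<And>K. \<lbrakk>compact K; K \<subseteq> ball 0 1\<rbrakk> \<Longrightarrow> uniform_limit K (g \<circ> r) h sequentially"
  proof (rule Montel[of "ball 0 1" "range g" g])
    show "\<exists>B. \<forall>h\<in>range g. \<forall>z\<in>K. norm (h z) \<le> B" if "compact K" "K \<subseteq> ball 0 1" for K
      using D(2) that by (intro exI[of _ M]) auto
  qed (use D in auto)
  have conv: "(\<lambda>i. (deriv ^^ s) (g (r i)) w) \<longlonglongrightarrow> (deriv ^^ s) h w" if w: "norm w < 1" for s w
  proof -
    obtain e where e: "norm w < e" "e < 1" using dense[OF w] by blast
    have "uniform_limit (cball 0 e) (g \<circ> r) h sequentially" using e by (intro lim) auto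
    then have "uniform_limit (ball 0 e) (g \<circ> r) h sequentially"
      by (rule uniform_limit_on_subset) auto
    then have "(\<lambda>i. (deriv ^^ s) ((g \<circ> r) i) w) \<longlonglongrightarrow> (deriv ^^ s) h w"
    proof (rule higher_deriv_complex_uniform_limit)
      have "(g \<circ> r) i holomorphic_on ball 0 e" for i
        using D(1)[of "r i"] e by (auto intro: holomorphic_on_subset[of _ "ball 0 1"])
      then show "\<forall>\<^sub>F i in sequentially. (g \<circ> r) i holomorphic_on ball 0 e" by simp
    qed (use e in auto)
    then show ?thesis by (simp add: o_def)
  qed
  have "A_bound m \<alpha> M h" unfolding A_bound_def
  proof (intro conjI ballI)
    fix w :: complex assume "w \<in> ball 0 1"
    then have w: "norm w < 1" by simp
    show "norm (h w) \<le> M"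
      using conv[OF w, of 0] D(2)[OF w] by (intro tendsto_upperbound[OF tendsto_norm]) auto
    show "norm ((deriv ^^ m) h w) \<le> M * (1 - norm w) powr (\<alpha> - real m)"
      using conv[OF w, of m] D(3)[OF w] by (intro tendsto_upperbound[OF tendsto_norm]) auto
  qed (fact h)
  then show ?thesis using that h conv by blast
qed

section \<open>Finite Blaschke products\<close>

lemma one_minus_cnj_mult_nonzero:
  fixes a w :: complex
  assumes "norm a < 1" "norm w \<le> 1"
  shows "1 - cnj a * w \<noteq> 0"
proof
  assume "1 - cnj a * w = 0"
  then have "norm (cnj a * w) = 1" by (metis eq_iff_diff_eq_0 norm_one)
  moreover have "norm a * norm w \<le> norm a" using assms by (intro mult_left_le) auto
  ultimately show False using assms by (simp add: norm_mult)
qed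

lemma one_minus_norm_blaschke_factor_sq:
  assumes "norm a < 1" "norm w \<le> 1"
  shows "1 - (norm (blaschke_factor a w))\<^sup>2
    = (1 - (norm a)\<^sup>2) * (1 - (norm w)\<^sup>2) / (norm (1 - cnj a * w))\<^sup>2"
proof (cases "a = 0")
  case False
  have "complex_of_real ((norm (1 - cnj a * w))\<^sup>2 - (norm (a - w))\<^sup>2)
      = complex_of_real ((1 - (norm a)\<^sup>2) * (1 - (norm w)\<^sup>2))"
    by (simp only: of_real_diff of_real_mult of_real_1 complex_norm_square) (simp add: algebra_simps)
  then have E: "(norm (1 - cnj a * w))\<^sup>2 - (norm (a - w))\<^sup>2 = (1 - (norm a)\<^sup>2) * (1 - (norm w)\<^sup>2)"
    by (simp only: of_real_eq_iff)
  have N: "norm (blaschke_factor a w) = norm (a - w) / norm (1 - cnj a * w)"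
    using False by (simp add: blaschke_factor_def norm_mult norm_divide)
  show ?thesis
    using one_minus_cnj_mult_nonzero[OF assms] by (simp add: N power_divide E[symmetric] diff_divide_distrib)
qed (simp add: blaschke_factor_def)

lemma norm_blaschke_factor_le_1:
  assumes "norm a < 1" "norm w \<le> 1"
  shows "norm (blaschke_factor a w) \<le> 1"
proof -
  have "0 \<le> 1 - (norm (blaschke_factor a w))\<^sup>2"
    unfolding one_minus_norm_blaschke_factor_sq[OF assms] using assms
    by (intro divide_nonneg_nonneg mult_nonneg_nonneg) (auto simp: power_le_one)
  then show ?thesis by (simp add: power2_le_iff_abs_le abs_square_le_1)
qed

text \<open>The zero-free cofactor of \<open>w - a\<close>, by which powers of Blaschke factors are
  compared with powers of \<open>w - a\<close>.\<close>

definition blaschke_unit :: "complex \<Rightarrow> complex \<Rightarrow> complex" where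
  "blaschke_unit a w = (if a = 0 then 1 else - cnj a / of_real (norm a) / (1 - cnj a * w))"

lemma blaschke_factor_eq_unit: "blaschke_factor a w = (w - a) * blaschke_unit a w"
  by (simp add: blaschke_factor_def blaschke_unit_def divide_simps)  (simp add: algebra_simps)

lemma blaschke_unit_nonzero:
  assumes "norm a < 1" "norm w \<le> 1"
  shows "blaschke_unit a w \<noteq> 0"
  using one_minus_cnj_mult_nonzero[OF assms] by (simp add: blaschke_unit_def)

lemma holomorphic_on_blaschke_unit [holomorphic_intros]:
  assumes "norm a < 1"
  shows "blaschke_unit a holomorphic_on ball 0 1"
proof (cases "a = 0")
  case False
  have "(\<lambda>w. - cnj a / of_real (norm a) / (1 - cnj a * w)) holomorphic_on ball 0 1"
    using one_minus_cnj_mult_nonzero[OF assms] by (intro holomorphic_intros) auto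
  with False show ?thesis by (simp add: blaschke_unit_def[abs_def])
qed (simp add: blaschke_unit_def[abs_def])

lemma holomorphic_on_blaschke_factor [holomorphic_intros]:
  assumes "norm a < 1"
  shows "blaschke_factor a holomorphic_on ball 0 1"
  unfolding blaschke_factor_eq_unit[abs_def] using assms by (intro holomorphic_intros)

lemma norm_blaschke_unit_self:
  assumes "norm a < 1"
  shows "norm (blaschke_unit a a) = 1 / (1 - (norm a)\<^sup>2)"
proof -
  have "1 - cnj a * a = of_real (1 - (norm a)\<^sup>2)"
    unfolding of_real_diff complex_norm_square by (simp add: mult.commute)
  moreover have "(norm a)\<^sup>2 < 1" using assms by (simp add: power_less_one_iff)
  ultimately have "norm (1 - cnj a * a) = 1 - (norm a)\<^sup>2"
    by (simp only: norm_of_real)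
  then show ?thesis by (simp add: blaschke_unit_def norm_divide norm_mult)
qed

lemma blaschke_factor_eq_0_iff:
  assumes "norm a < 1" "norm w \<le> 1"
  shows "blaschke_factor a w = 0 \<longleftrightarrow> w = a"
  using blaschke_unit_nonzero[OF assms] by (simp add: blaschke_factor_eq_unit)

text \<open>The filter \<open>filtercomap norm (at_left 1)\<close> expresses |w| -> 1 from inside
  uniformly in the direction, as the maximum principle on circles requires.\<close>

lemma tendsto_norm_blaschke_factor:
  assumes a: "norm a < 1"
  shows "((\<lambda>w. norm (blaschke_factor a w)) \<longlongrightarrow> 1) (filtercomap norm (at_left 1))"
proof (rule tendsto_sandwich)
  let ?F = "filtercomap norm (at_left (1::real)) :: complex filter"
  have ev: "\<forall>\<^sub>F w::complex in ?F. norm w < 1"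
    unfolding eventually_filtercomap
    by (intro exI[of _ "\<lambda>r. r < 1"]) (auto simp: eventually_at_left_field intro: exI[of _ 0])
  show "\<forall>\<^sub>F w in ?F. norm (blaschke_factor a w) \<le> 1"
    using ev by eventually_elim (use a in \<open>auto intro: norm_blaschke_factor_le_1\<close>)
  show "\<forall>\<^sub>F w in ?F. 1 - (1 - (norm w)\<^sup>2) / (1 - norm a)\<^sup>2 \<le> norm (blaschke_factor a w)"
    using ev
  proof eventually_elim
    case (elim w)
    have w: "norm w \<le> 1" using elim by simp
    let ?b = "norm (blaschke_factor a w)"
    have "1 - norm a \<le> norm (1 - cnj a * w)"
    proof -
      have "norm a * norm w \<le> norm a" using w by (intro mult_left_le) auto
      then show ?thesis using norm_triangle_ineq2[of 1 "cnj a * w"] by (simp add: norm_mult)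
    qed
    then have den: "(1 - norm a)\<^sup>2 \<le> (norm (1 - cnj a * w))\<^sup>2" using a by (intro power_mono) auto
    have "1 - ?b \<le> 1 - ?b\<^sup>2"
      using norm_blaschke_factor_le_1[OF a w] by (simp add: power2_eq_square mult_left_le)
    also have "\<dots> \<le> 1 * (1 - (norm w)\<^sup>2) / (1 - norm a)\<^sup>2"
      unfolding one_minus_norm_blaschke_factor_sq[OF a w] using a w den
      by (intro frac_le mult_right_mono) (auto simp: power_le_one)
    finally show ?case by simp
  qed
  have "((\<lambda>r::real. 1 - (1 - r\<^sup>2) / (1 - norm a)\<^sup>2) \<longlongrightarrow> 1 - (1 - 1\<^sup>2) / (1 - norm a)\<^sup>2) (at_left 1)"
    using a by (intro tendsto_intros) auto
  then show "((\<lambda>w. 1 - (1 - (norm w)\<^sup>2) / (1 - norm a)\<^sup>2) \<longlongrightarrow> 1) ?F"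
    by (intro filterlim_filtercomapI[of "\<lambda>r. 1 - (1 - r\<^sup>2) / (1 - norm a)\<^sup>2"]) auto
qed auto

definition fin_blaschke :: "complex set \<Rightarrow> complex \<Rightarrow> complex" where
  "fin_blaschke S w = (\<Prod>a\<in>S. blaschke_factor a w)"

lemma norm_fin_blaschke_le_1:
  assumes "S \<subseteq> ball 0 1" "norm w \<le> 1"
  shows "norm (fin_blaschke S w) \<le> 1"
  unfolding fin_blaschke_def prod_norm[symmetric]
  using assms norm_blaschke_factor_le_1 by (auto intro!: prod_le_1)

lemma holomorphic_on_fin_blaschke [holomorphic_intros]:
  assumes "S \<subseteq> ball 0 1"
  shows "fin_blaschke S holomorphic_on ball 0 1"
  unfolding fin_blaschke_def[abs_def] using assms by (intro holomorphic_intros) auto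

lemma fin_blaschke_eq_0_iff:
  assumes "finite S" "S \<subseteq> ball 0 1" "norm w \<le> 1"
  shows "fin_blaschke S w = 0 \<longleftrightarrow> w \<in> S"
  using assms blaschke_factor_eq_0_iff[of _ w] by (simp add: fin_blaschke_def subset_eq)

lemma norm_fin_blaschke_near_circle:
  assumes S: "S \<subseteq> ball 0 1" and c: "c < 1"
  obtains \<rho> where "\<rho> < 1" "\<And>w. \<rho> < norm w \<Longrightarrow> norm w < 1 \<Longrightarrow> c < norm (fin_blaschke S w) ^ k"
proof -
  have "((\<lambda>w. norm (blaschke_factor a w)) \<longlongrightarrow> 1) (filtercomap norm (at_left 1))" if "a \<in> S" for a
    using S that by (intro tendsto_norm_blaschke_factor) auto
  then have "((\<lambda>w. norm (fin_blaschke S w) ^ k) \<longlongrightarrow> (\<Prod>a\<in>S. 1) ^ k) (filtercomap norm (at_left 1))"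
    unfolding fin_blaschke_def prod_norm[symmetric] by (intro tendsto_power tendsto_prod)
  then have "\<forall>\<^sub>F w in filtercomap norm (at_left 1). c < norm (fin_blaschke S w) ^ k"
    using c by (intro order_tendstoD) auto
  then obtain \<rho> where "\<rho> < 1" "\<forall>r. \<rho> < r \<longrightarrow> r < 1 \<longrightarrow> (\<forall>w. norm w = r \<longrightarrow> c < norm (fin_blaschke S w) ^ k)"
    unfolding eventually_filtercomap eventually_at_left_field by (metis (no_types, lifting))
  then show ?thesis using that by blast
qed

text \<open>Maximum principle on a circle so close to the boundary that the k-th power of the
  Blaschke product exceeds some c < 1 in modulus there: |q| <= M / c, and c may be taken arbitrarily
  close to 1.\<close>

lemma bound_divide_fin_blaschke:
  assumes S: "S \<subseteq> ball 0 1" and q: "q holomorphic_on ball 0 1"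
    and le: "\<And>w. norm w < 1 \<Longrightarrow> norm (q w * fin_blaschke S w ^ k) \<le> M" and w: "norm w < 1"
  shows "norm (q w) \<le> M"
proof (rule ccontr)
  assume "\<not> norm (q w) \<le> M"
  moreover have M: "0 \<le> M" using le[OF w] norm_ge_zero order_trans by blast
  ultimately have Q: "M < norm (q w)" "0 < norm (q w)" by auto
  \<comment> \<open>The midpoint of M / |q w| and 1; any c strictly between them makes M / c smaller
    than |q w|.\<close>
  define c where "c = (M / norm (q w) + 1) / 2"
  have c: "M / norm (q w) < c" "c < 1" "0 < c"
    using Q M by (auto simp: c_def field_simps intro!: add_pos_nonneg)
  obtain \<rho> where \<rho>: "\<rho> < 1" "\<And>u. \<rho> < norm u \<Longrightarrow> norm u < 1 \<Longrightarrow> c < norm (fin_blaschke S u) ^ k"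
    using norm_fin_blaschke_near_circle[OF S c(2)] by metis
  obtain r where r: "max \<rho> (norm w) < r" "r < 1" using dense[of "max \<rho> (norm w)" 1] \<rho> w by auto
  have "norm (q w) \<le> M / c"
  proof (rule maximum_modulus_frontier[where S = "cball 0 r" and f = q])
    show "q holomorphic_on interior (cball 0 r)" "continuous_on (closure (cball 0 r)) q"
      using q r by (auto intro!: holomorphic_on_imp_continuous_on elim!: holomorphic_on_subset)
    fix u :: complex assume "u \<in> frontier (cball 0 r)"
    then have u: "norm u = r" using r by (simp add: frontier_def)
    have "norm (q u) * c \<le> norm (q u) * norm (fin_blaschke S u) ^ k"
      using \<rho>(2)[of u] u r by (intro mult_left_mono) auto
    also have "\<dots> \<le> M" using le[of u] u r by (simp add: norm_mult norm_power)
    finally show "norm (q u) \<le> M / c" using c by (simp add: field_simps)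
  qed (use r in auto)
  also have "\<dots> < norm (q w)" using c Q by (simp add: field_simps)
  finally show False by simp
qed

section \<open>Splitting off zeros of prescribed order\<close>

lemma higher_deriv_linear_power_mult:
  fixes u :: "complex \<Rightarrow> complex"
  assumes u: "u holomorphic_on S" "open S" "a \<in> S"
  shows "i < k \<Longrightarrow> (deriv ^^ i) (\<lambda>w. (w - a) ^ k * u w) a = 0"
    and "(deriv ^^ k) (\<lambda>w. (w - a) ^ k * u w) a = fact k * u a"
proof -
  \<comment> \<open>The i-th derivative of the power at \<open>a\<close> carries
    \<open>0 ^ (k - i)\<close>; for m <= k, and with \<open>0 ^ 0 = 1\<close>, only the term i = k
    can survive.\<close>
  have *: "(deriv ^^ m) (\<lambda>w. (w - a) ^ k * u w) a
     = (\<Sum>i=0..m. of_nat (m choose i) * (pochhammer (of_nat (Suc k - i)) i * 0 ^ (k - i)) * (deriv ^^ (m - i)) u a)" for m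
    using u by (subst higher_deriv_mult[where S = S]) (auto intro!: holomorphic_intros simp: higher_deriv_power)
  show "(deriv ^^ i) (\<lambda>w. (w - a) ^ k * u w) a = 0" if "i < k"
    unfolding * using that by (intro sum.neutral) auto
  have "(deriv ^^ k) (\<lambda>w. (w - a) ^ k * u w) a
      = (\<Sum>i=0..k. if i = k then fact k * u a else 0)"
    unfolding * by (intro sum.cong) (auto simp: pochhammer_fact)
  then show "(deriv ^^ k) (\<lambda>w. (w - a) ^ k * u w) a = fact k * u a" by simp
qed

lemma holomorphic_factor_linear_power:
  fixes h :: "complex \<Rightarrow> complex"
  assumes h: "h holomorphic_on S" "open S" "a \<in> S" and 0: "\<And>i. i < k \<Longrightarrow> (deriv ^^ i) h a = 0"
  shows "\<exists>u. u holomorphic_on S \<and> (\<forall>w\<in>S. h w = (w - a) ^ k * u w)"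
  using 0
proof (induction k)
  case (Suc k)
  then obtain u where u: "u holomorphic_on S" "\<And>w. w \<in> S \<Longrightarrow> h w = (w - a) ^ k * u w" by auto
  have "(deriv ^^ k) h a = (deriv ^^ k) (\<lambda>w. (w - a) ^ k * u w) a"
    using h u by (intro higher_deriv_transform_within_open[of _ S]) (auto intro!: holomorphic_intros)
  then have "u a = 0"
    using Suc.prems[of k] higher_deriv_linear_power_mult(2)[OF u(1) h(2,3)] by simp
  define v where "v = (\<lambda>w. if w = a then deriv u a else (u w - u a) / (w - a))"
  have "v holomorphic_on S" unfolding v_def using h u by (intro pole_lemma) (auto simp: interior_open)
  moreover have "h w = (w - a) ^ Suc k * v w" if "w \<in> S" for w
    using u(2)[OF that] \<open>u a = 0\<close> by (auto simp: v_def)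
  ultimately show ?case by blast
qed (use h in auto)

text \<open>Zeros are removed one at a time. At a new zero \<open>a\<close> two quotients are at
  hand, \<open>q\<close> without the old zeros and \<open>u\<close> without the new one; they give
  formulas for \<open>q'\<close> off \<open>S\<close> and off \<open>a\<close> that agree on the
  overlap, and these two open sets cover the disc because \<open>a\<close> is not in
  \<open>S\<close>.\<close>

lemma holomorphic_factor_fin_blaschke:
  assumes h: "h holomorphic_on ball 0 1" and S: "finite S" "S \<subseteq> ball 0 1"
    and 0: "\<And>a i. a \<in> S \<Longrightarrow> i < k \<Longrightarrow> (deriv ^^ i) h a = 0"
  obtains q where "q holomorphic_on ball 0 1" "\<And>w. norm w < 1 \<Longrightarrow> h w = q w * fin_blaschke S w ^ k"
proof -
  have "\<exists>q. q holomorphic_on ball 0 1 \<and> (\<forall>w\<in>ball 0 1. h w = q w * fin_blaschke S w ^ k)"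
    using S 0
  proof (induction S)
    case empty
    then show ?case using h by (auto simp: fin_blaschke_def)
  next
    case (insert a S)
    let ?D = "ball 0 1 :: complex set"
    obtain q where q: "q holomorphic_on ?D" "\<And>w. w \<in> ?D \<Longrightarrow> h w = q w * fin_blaschke S w ^ k"
      using insert by auto
    have a: "a \<in> ?D" "norm a < 1" using insert by auto
    obtain u where u: "u holomorphic_on ?D" "\<And>w. w \<in> ?D \<Longrightarrow> h w = (w - a) ^ k * u w"
      using holomorphic_factor_linear_power[OF h _ a(1), of k] insert by auto
    define q' where "q' = (\<lambda>w. if w = a then u w / (fin_blaschke S w * blaschke_unit a w) ^ k
        else q w / blaschke_factor a w ^ k)"
    have nz: "fin_blaschke S w \<noteq> 0" if "w \<in> ?D - S" for w
      using that insert by (subst fin_blaschke_eq_0_iff) auto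
    have "(\<lambda>w. u w / (fin_blaschke S w * blaschke_unit a w) ^ k) holomorphic_on (?D - S)"
      using nz u(1) a insert.prems blaschke_unit_nonzero[OF a(2)]
      by (intro holomorphic_intros holomorphic_on_subset[OF holomorphic_on_blaschke_unit]
          holomorphic_on_subset[OF holomorphic_on_fin_blaschke] holomorphic_on_subset[OF u(1)]) auto
    moreover have "q' w = u w / (fin_blaschke S w * blaschke_unit a w) ^ k" if w: "w \<in> ?D - S" for w
    proof (cases "w = a")
      case False
      have "q w * fin_blaschke S w ^ k = (w - a) ^ k * u w" using q u w by simp
      then show ?thesis
        using False nz[OF w] blaschke_unit_nonzero[OF a(2), of w] w
        by (simp add: q'_def blaschke_factor_eq_unit power_mult_distrib divide_simps ac_simps)
    qed (simp add: q'_def)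
    ultimately have 1: "q' holomorphic_on (?D - S)"
      by (metis (no_types, lifting) holomorphic_transform)
    have "(\<lambda>w. q w / blaschke_factor a w ^ k) holomorphic_on (?D - {a})"
      using blaschke_factor_eq_0_iff[OF a(2)] a q(1)
      by (intro holomorphic_intros holomorphic_on_subset[OF holomorphic_on_blaschke_factor]
          holomorphic_on_subset[OF q(1)]) auto
    then have 2: "q' holomorphic_on (?D - {a})"
      by (rule holomorphic_transform) (simp add: q'_def)
    have "?D = (?D - S) \<union> (?D - {a})" using insert by auto
    then have "q' holomorphic_on ?D"
      using holomorphic_on_Un[OF 1 2] insert by (metis finite.emptyI finite_imp_closed finite_insert open_Diff open_ball)
    moreover have "h w = q' w * fin_blaschke (insert a S) w ^ k" if w: "w \<in> ?D" for w
    proof (cases "w = a \<and> k > 0")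
      case True
      then show ?thesis using u(2)[OF w] insert by (simp add: fin_blaschke_def blaschke_factor_eq_unit)
    next
      case False
      have "fin_blaschke (insert a S) w = blaschke_factor a w * fin_blaschke S w"
        using insert by (simp add: fin_blaschke_def)
      then show ?thesis
        using False q(2)[OF w] u(2)[OF w] blaschke_factor_eq_0_iff[OF a(2), of w] w
        by (cases "w = a") (auto simp: q'_def power_mult_distrib)
    qed
    ultimately show ?case by blast
  qed
  then show ?thesis using that by auto
qed

section \<open>Division by finite Blaschke products\<close>

lemma circlepath_has_contour_integral_iff:
  "(f has_contour_integral I) (circlepath 0 r) \<longleftrightarrow>
    ((\<lambda>t. f (of_real r * exp (2 * of_real pi * \<i> * of_real t)) * (2 * pi * \<i> * r * exp (2 * of_real pi * \<i> * of_real t)))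
      has_integral I) {0..1}"
  unfolding has_contour_integral vector_derivative_circlepath by (simp add: circlepath)

text \<open>The sign in d\<zeta> = - dw / w^2 cancels against the reversed orientation of the
  circle; in the parametrisation this is the substitution t -> 1 - t.\<close>

lemma has_contour_integral_circlepath_inversion:
  fixes G H :: "complex \<Rightarrow> complex"
  assumes r: "r > 0" and H: "(H has_contour_integral I) (circlepath 0 (1 / r))"
    and GH: "\<And>w. norm w = 1 / r \<Longrightarrow> H w = G (1 / w) / w\<^sup>2"
  shows "(G has_contour_integral I) (circlepath 0 r)"
proof -
  let ?e = "\<lambda>t::real. exp (2 * of_real pi * \<i> * of_real t) :: complex"
  have "((\<lambda>t. H (of_real (1 / r) * ?e t) * (2 * pi * \<i> * (1 / r) * ?e t)) has_integral I) {0..1}"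
    using H circlepath_has_contour_integral_iff[of H I "1 / r"] by simp
  from has_integral_affinity[OF this[unfolded box_real(2)[symmetric]], of "- 1" 1]
  have "((\<lambda>t. H (of_real (1 / r) * ?e (1 - t)) * (2 * pi * \<i> * (1 / r) * ?e (1 - t))) has_integral I) {0..1}"
    by (simp add: algebra_simps)
  moreover have "H (of_real (1 / r) * ?e (1 - t)) * (2 * pi * \<i> * (1 / r) * ?e (1 - t))
      = G (of_real r * ?e t) * (2 * pi * \<i> * r * ?e t)" for t
  proof -
    have e: "?e (1 - t) = inverse (?e t)"
      by (simp add: exp_minus[symmetric] right_diff_distrib exp_diff inverse_eq_divide)
    have ne: "norm (?e t) = 1" by (simp add: norm_exp_eq_Re)
    have "H (of_real (1 / r) * inverse (?e t))
        = G (1 / (of_real (1 / r) * inverse (?e t))) / (of_real (1 / r) * inverse (?e t))\<^sup>2"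
      using r ne by (intro GH) (simp add: norm_mult norm_inverse norm_divide)
    then show ?thesis
      unfolding e using r by (simp add: field_simps power2_eq_square)
  qed
  ultimately show ?thesis
    unfolding circlepath_has_contour_integral_iff by simp
qed

text \<open>All poles of the integrand lie inside the circle and it is \<open>O(1 / \<zeta>\<^sup>2)\<close> at infinity,
  which the substitution \<open>\<zeta> = 1 / w\<close> turns into holomorphy near \<open>0\<close>.\<close>

lemma contour_integral_monomial_over_fin_blaschke:
  assumes S: "S \<subseteq> ball 0 r" and r: "0 < r" "r \<le> 1" and z: "norm z < r" and ip: "i + 2 \<le> p"
  shows "((\<lambda>\<zeta>. \<zeta> ^ i / (fin_blaschke S \<zeta> ^ k * (\<zeta> - z) ^ p)) has_contour_integral 0) (circlepath 0 r)"
proof (rule has_contour_integral_circlepath_inversion[OF \<open>0 < r\<close>])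
  \<comment> \<open>\<open>B a w\<close> is the reciprocal of the Blaschke factor at 1 / w; its pole
    1 / a lies outside the disc of radius 1 / r because |a| < r.\<close>
  define B where "B = (\<lambda>a w. if a = 0 then w
    else of_real (norm a) / cnj a * ((w - cnj a) / (a * w - 1)) :: complex)"
  \<comment> \<open>The exponent p - i - 2 is a true difference by i + 2 <= p; the 2 comes from
    d\<zeta>.\<close>
  define H where "H = (\<lambda>w. w ^ (p - i - 2) * (\<Prod>a\<in>S. B a w) ^ k / (1 - z * w) ^ p)"
  have lt1: "norm (a * w) < 1" if "norm a < r" "norm w \<le> 1 / r" for a w :: complex
  proof -
    have "norm a * norm w \<le> norm a * (1 / r)" using that by (intro mult_left_mono) auto
    also have "\<dots> < 1" using that r by simp
    finally show ?thesis by (simp add: norm_mult)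
  qed
  have nz: "a * w \<noteq> 1" if "norm a < r" "norm w \<le> 1 / r" for a w :: complex
    using lt1[OF that] by auto
  have "B a holomorphic_on cball 0 (1 / r)" if "a \<in> S" for a
    unfolding B_def using nz[of a] S that by (cases "a = 0") (auto intro!: holomorphic_intros)
  then have "H holomorphic_on cball 0 (1 / r)"
    unfolding H_def using nz[OF z] by (intro holomorphic_intros) auto
  then show "(H has_contour_integral 0) (circlepath 0 (1 / r))"
    using r by (intro Cauchy_theorem_convex_simple[of _ "cball 0 (1 / r)"]) auto
  fix w :: complex assume w: "norm w = 1 / r"
  have w0: "w \<noteq> 0" using w r by auto
  have "inverse (blaschke_factor a (1 / w)) = B a w" if "a \<in> S" for a
  proof (cases "a = 0")
    case False
    have "a \<noteq> 1 / w" using nz[of a w] S that w w0 by (auto simp: field_simps)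
    then show ?thesis
      using False w0 nz[of a w] S that w by (auto simp: B_def blaschke_factor_def divide_simps)
  qed (simp add: B_def blaschke_factor_def)
  then have B: "inverse (fin_blaschke S (1 / w)) = (\<Prod>a\<in>S. B a w)"
    unfolding fin_blaschke_def prod_inversef[symmetric] o_def by (intro prod.cong) auto
  have p: "p = (p - i - 2) + i + 2" using ip by simp
  have "(1 / w) ^ i / (1 / w - z) ^ p / w\<^sup>2 = w ^ (p - i - 2) / (1 - z * w) ^ p"
  proof -
    have "(1 / w) ^ i / (((1 - z * w) ^ p) / (w ^ (p - i - 2) * w ^ i * w\<^sup>2)) / w\<^sup>2 = w ^ (p - i - 2) / (1 - z * w) ^ p"
      using w0 by (simp add: power_one_over field_simps)
    moreover have "(1 / w - z) ^ p = (1 - z * w) ^ p / w ^ p" using w0 by (simp add: power_divide[symmetric] diff_divide_distrib)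
    moreover have "w ^ p = w ^ (p - i - 2) * w ^ i * w\<^sup>2" by (subst p) (simp only: power_add)
    ultimately show ?thesis by metis
  qed
  then show "H w = (1 / w) ^ i / (fin_blaschke S (1 / w) ^ k * (1 / w - z) ^ p) / w\<^sup>2"
    unfolding H_def B[symmetric] by (simp add: divide_inverse power_inverse mult.assoc mult.left_commute mult.commute)
qed

text \<open>Cauchy's formula at z for the function 1 / (r^2 - cnj z u), holomorphic near the closed
  disc of radius r. On the circle r^2 = \<zeta> cnj \<zeta> turns its integrand into 1 / |\<zeta> -
  z|^2.\<close>

lemma poisson_integral:
  assumes z: "norm z < r"
  shows "((\<lambda>t. 1 / (norm (of_real r * exp (2 * of_real pi * \<i> * of_real t) - z))\<^sup>2)
    has_integral 1 / (r\<^sup>2 - (norm z)\<^sup>2)) {0..1}"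
proof -
  have r: "0 < r" using z norm_ge_zero[of z] by linarith
  let ?\<zeta> = "\<lambda>t::real. of_real r * exp (2 * of_real pi * \<i> * of_real t) :: complex"
  have nz: "of_real (r\<^sup>2) - cnj z * u \<noteq> 0" if "norm u \<le> r" for u
  proof
    assume "of_real (r\<^sup>2) - cnj z * u = 0"
    then have "norm (of_real (r\<^sup>2) :: complex) = norm (cnj z * u)" by simp
    then have "r\<^sup>2 = norm z * norm u" by (simp add: norm_mult del: of_real_power)
    also have "\<dots> \<le> norm z * r" using that by (intro mult_left_mono) auto
    also have "\<dots> < r\<^sup>2" using z r by (simp add: power2_eq_square)
    finally show False by simp
  qed
  have "((\<lambda>u. 1 / (of_real (r\<^sup>2) - cnj z * u) / (u - z)) has_contour_integral
      2 * of_real pi * \<i> * (1 / (of_real (r\<^sup>2) - cnj z * z))) (circlepath 0 r)"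
    using z nz by (intro Cauchy_integral_circlepath_simple) (auto intro!: holomorphic_intros)
  then have "((\<lambda>t. 1 / (of_real (r\<^sup>2) - cnj z * ?\<zeta> t) / (?\<zeta> t - z) * (2 * pi * \<i> * ?\<zeta> t)) has_integral
      2 * of_real pi * \<i> * (1 / (of_real (r\<^sup>2) - cnj z * z))) {0..1}"
    unfolding circlepath_has_contour_integral_iff by (simp add: mult.assoc)
  from has_integral_mult_right[OF this, of "1 / (2 * pi * \<i>)"]
  have "((\<lambda>t. ?\<zeta> t / ((of_real (r\<^sup>2) - cnj z * ?\<zeta> t) * (?\<zeta> t - z))) has_integral
      1 / (of_real (r\<^sup>2) - cnj z * z)) {0..1}"
    by simp
  moreover have "?\<zeta> t / ((of_real (r\<^sup>2) - cnj z * ?\<zeta> t) * (?\<zeta> t - z)) = of_real (1 / (norm (?\<zeta> t - z))\<^sup>2)" for t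
  proof -
    have n: "norm (?\<zeta> t) = r" using r by (simp add: norm_mult norm_exp_eq_Re)
    have "of_real (r\<^sup>2) = ?\<zeta> t * cnj (?\<zeta> t)" using complex_norm_square[of "?\<zeta> t"] unfolding n .
    then have eq: "(of_real (r\<^sup>2) - cnj z * ?\<zeta> t) * (?\<zeta> t - z) = ?\<zeta> t * ((?\<zeta> t - z) * cnj (?\<zeta> t - z))"
      by (simp add: algebra_simps)
    have "?\<zeta> t \<noteq> 0" using r by simp
    then show ?thesis unfolding eq of_real_divide complex_norm_square by (simp del: complex_cnj_diff)
  qed
  moreover have "1 / (of_real (r\<^sup>2) - cnj z * z) = (of_real (1 / (r\<^sup>2 - (norm z)\<^sup>2)) :: complex)"
    unfolding of_real_diff of_real_divide complex_norm_square by (simp add: mult.commute)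
  ultimately have "((\<lambda>t. complex_of_real (1 / (norm (?\<zeta> t - z))\<^sup>2)) has_integral of_real (1 / (r\<^sup>2 - (norm z)\<^sup>2))) {0..1}"
    by simp
  from has_integral_linear[OF this bounded_linear_Re] show ?thesis by (simp add: o_def)
qed

text \<open>Havin's division property. Since the integral of the Taylor polynomial of \<open>h\<close> at \<open>z\<close> vanishes,
  the Cauchy formula for the \<open>(n + 2)\<close>-nd derivative of \<open>q = h / B\<^sup>k\<close> involves only the Taylor
  remainder of \<open>h\<close>; order \<open>n + 2\<close> makes the resulting integral comparable with a Poisson integral.\<close>

lemma A_bound_divide_fin_blaschke:
  assumes n: "real n < \<alpha>" "\<alpha> < real n + 1" and h: "A_bound (Suc n) \<alpha> M h"
    and S: "finite S" "S \<subseteq> ball 0 1" and q: "q holomorphic_on ball 0 1"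
    and hq: "\<And>w. norm w < 1 \<Longrightarrow> h w = q w * fin_blaschke S w ^ k"
    and K: "K = (2 / (\<alpha> - real n) + 1) * M"
  shows "A_bound (n + 2) \<alpha> (max M (8 * fact (n + 2) * K)) q"
proof -
  note D = A_boundD[OF h]
  have K0: "K \<ge> 0" using n D(4) by (auto simp: K)
  have qM: "norm (q w) \<le> M" if "norm w < 1" for w
    using bound_divide_fin_blaschke[OF S(2) q _ that, of k M] hq D(2) by metis
  have dq: "norm ((deriv ^^ (n + 2)) q z) \<le> 8 * fact (n + 2) * K * (1 - norm z) powr (\<alpha> - real (n + 2))"
    if z: "norm z < 1" for z
  proof -
    obtain \<rho> where \<rho>: "\<rho> < 1" "\<And>u. \<rho> < norm u \<Longrightarrow> norm u < 1 \<Longrightarrow> 1 / 2 < norm (fin_blaschke S u) ^ k"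
      using norm_fin_blaschke_near_circle[OF S(2), of "1 / 2" k] by auto
    \<comment> \<open>The circle must enclose all zeros, for the integral of the Taylor polynomial
      to vanish, lie where the Blaschke power exceeds 1 / 2, and satisfy r - |z| >= (1 - |z|) / 2.
      Only the last two bounds enter the constants, so these do not depend on
      \<open>S\<close>.\<close>
    define m where "m = Max (insert ((1 + norm z) / 2) (insert \<rho> (norm ` S)))"
    have "m < 1" unfolding m_def using S \<rho>(1) z by (subst Max_less_iff) auto
    then obtain r where r: "m < r" "r < 1" using dense by blast
    have m: "x \<le> m" if "x \<in> insert ((1 + norm z) / 2) (insert \<rho> (norm ` S))" for x
      unfolding m_def using S that by (intro Max_ge) auto
    have rz: "(1 + norm z) / 2 < r" "\<rho> < r" using m[of "(1 + norm z) / 2"] m[of \<rho>] r by auto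
    have Sr: "S \<subseteq> ball 0 r"
    proof
      fix a assume "a \<in> S"
      then show "a \<in> ball 0 r" using m[of "norm a"] r by auto
    qed
    have "norm z < (1 + norm z) / 2" using z by simp
    also note rz(1)
    finally have "norm z < r" .
    moreover have "0 < r" using calculation norm_ge_zero[of z] by linarith
    ultimately have zr: "norm z < r" "0 < r" by blast+
    let ?e = "\<lambda>t::real. exp (2 * of_real pi * \<i> * of_real t) :: complex"
    let ?\<zeta> = "\<lambda>t::real. of_real r * ?e t"
    have \<zeta>: "norm (?\<zeta> t) = r" for t using zr by (simp add: norm_mult norm_exp_eq_Re)
    define P where "P = (\<lambda>\<zeta>. \<Sum>m=0..n. (deriv ^^ m) h z / fact m * (\<zeta> - z) ^ m)"
    define F where "F = (\<lambda>\<zeta>. (h \<zeta> - P \<zeta>) / (fin_blaschke S \<zeta> ^ k * (\<zeta> - z) ^ (n + 3)))"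
    have "((\<lambda>\<zeta>. q \<zeta> / (\<zeta> - z) ^ Suc (n + 2)) has_contour_integral
        2 * pi * \<i> / fact (n + 2) * (deriv ^^ (n + 2)) q z) (circlepath 0 r)"
      using q r zr by (intro Cauchy_has_contour_integral_higher_derivative_circlepath)
        (auto intro!: holomorphic_on_imp_continuous_on elim!: holomorphic_on_subset)
    moreover have "((\<lambda>\<zeta>. P \<zeta> / (fin_blaschke S \<zeta> ^ k * (\<zeta> - z) ^ (n + 3))) has_contour_integral 0) (circlepath 0 r)"
    proof -
      have "((\<lambda>\<zeta>. \<Sum>m=0..n. (deriv ^^ m) h z / fact m *
          (\<Sum>i\<le>m. of_nat (m choose i) * (- z) ^ (m - i) * (\<zeta> ^ i / (fin_blaschke S \<zeta> ^ k * (\<zeta> - z) ^ (n + 3)))))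
          has_contour_integral (\<Sum>m=0..n. (deriv ^^ m) h z / fact m * (\<Sum>i\<le>m. of_nat (m choose i) * (- z) ^ (m - i) * 0))) (circlepath 0 r)"
        using Sr zr r by (intro has_contour_integral_sum has_contour_integral_lmul
            contour_integral_monomial_over_fin_blaschke) auto
      moreover have "(\<Sum>i\<le>m. of_nat (m choose i) * (- z) ^ (m - i) * (\<zeta> ^ i / D)) = (\<zeta> - z) ^ m / D" for m \<zeta> D
        using binomial_ring[of \<zeta> "- z" m] by (simp add: sum_divide_distrib mult.assoc mult.left_commute mult.commute)
      ultimately show ?thesis by (simp add: P_def sum_divide_distrib mult.commute[of "fact _"])
    qed
    ultimately have "((\<lambda>\<zeta>. q \<zeta> / (\<zeta> - z) ^ Suc (n + 2) - P \<zeta> / (fin_blaschke S \<zeta> ^ k * (\<zeta> - z) ^ (n + 3)))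
        has_contour_integral (2 * pi * \<i> / fact (n + 2) * (deriv ^^ (n + 2)) q z - 0)) (circlepath 0 r)"
      by (rule has_contour_integral_diff)
    moreover have Fq: "q (?\<zeta> t) / (?\<zeta> t - z) ^ Suc (n + 2)
        - P (?\<zeta> t) / (fin_blaschke S (?\<zeta> t) ^ k * (?\<zeta> t - z) ^ (n + 3)) = F (?\<zeta> t)" for t
    proof -
      have "1 / 2 < norm (fin_blaschke S (?\<zeta> t) ^ k)"
        unfolding norm_power by (rule \<rho>(2)) (use \<zeta>[of t] rz r in linarith)+
      then have "norm (fin_blaschke S (?\<zeta> t) ^ k) \<noteq> 0" by linarith
      then have "fin_blaschke S (?\<zeta> t) ^ k \<noteq> 0" by (simp only: norm_eq_zero not_False_eq_True)
      then have "q (?\<zeta> t) = h (?\<zeta> t) / fin_blaschke S (?\<zeta> t) ^ k"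
        using hq[of "?\<zeta> t"] r \<zeta>[of t] by (simp add: field_simps)
      then show ?thesis by (simp add: F_def diff_divide_distrib numeral_3_eq_3 del: power_Suc)
    qed
    ultimately have int: "((\<lambda>t. F (?\<zeta> t) * (2 * pi * \<i> * r * ?e t)) has_integral
        2 * pi * \<i> / fact (n + 2) * (deriv ^^ (n + 2)) q z) {0..1}"
      unfolding circlepath_has_contour_integral_iff by simp
    define c where "c = 2 * K * (r - norm z) powr (\<alpha> - real n - 1) * (2 * pi * r)"
    have le: "norm (F (?\<zeta> t) * (2 * pi * \<i> * r * ?e t)) \<le> c * (1 / (norm (?\<zeta> t - z))\<^sup>2)" for t
    proof -
      let ?d = "norm (?\<zeta> t - z)"
      have d: "r - norm z \<le> ?d" using norm_triangle_ineq2[of "?\<zeta> t" z] \<zeta>[of t] by simp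
      have d0: "0 < ?d" using d zr by linarith
      have "norm (h (?\<zeta> t) - P (?\<zeta> t)) \<le> K * ?d powr \<alpha>"
        using A_bound_taylor[OF n h z, of "?\<zeta> t" 0] \<zeta>[of t] r by (simp add: P_def K)
      moreover have "1 / 2 \<le> norm (fin_blaschke S (?\<zeta> t)) ^ k"
        using \<rho>(2)[of "?\<zeta> t"] rz r \<zeta>[of t] by auto
      ultimately have "norm (F (?\<zeta> t)) \<le> (K * ?d powr \<alpha>) / (1 / 2 * ?d ^ (n + 3))"
        unfolding F_def norm_divide norm_mult norm_power using d0 K0 by (intro frac_le mult_mono) auto
      \<comment> \<open>The exponent \<alpha> - n - 3 is split: \<alpha> - n - 1 is negative and
        gets estimated by the distance r - |z| to the circle, the remaining -2 is left to the
        Poisson integral.\<close>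
      also have "\<dots> = 2 * K * ?d powr (\<alpha> - real n - 1) * (1 / ?d\<^sup>2)"
      proof -
        have "?d powr (\<alpha> - real n - 1) = ?d powr \<alpha> / ?d ^ Suc n"
          using d0 by (simp only: powr_realpow[symmetric] powr_diff[symmetric]) (simp add: algebra_simps)
        then show ?thesis using d0 by (simp add: power_add field_simps eval_nat_numeral)
      qed
      also have "\<dots> \<le> 2 * K * (r - norm z) powr (\<alpha> - real n - 1) * (1 / ?d\<^sup>2)"
        using d zr K0 n by (intro mult_right_mono mult_left_mono powr_mono2') auto
      finally have "norm (F (?\<zeta> t)) * (2 * pi * r) \<le> 2 * K * (r - norm z) powr (\<alpha> - real n - 1) * (1 / ?d\<^sup>2) * (2 * pi * r)"
        using zr by (intro mult_right_mono) auto
      then show ?thesis using zr by (simp add: norm_mult norm_exp_eq_Re c_def ac_simps)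
    qed
    have "norm (integral {0..1} (\<lambda>t. F (?\<zeta> t) * (2 * pi * \<i> * r * ?e t)))
        \<le> integral {0..1} (\<lambda>t. c * (1 / (norm (?\<zeta> t - z))\<^sup>2))"
      using int has_integral_mult_right[OF poisson_integral[OF zr(1)], of c] le
      by (intro integral_norm_bound_integral) (auto simp: integrable_on_def)
    then have "norm (2 * pi * \<i> / fact (n + 2) * (deriv ^^ (n + 2)) q z) \<le> c * (1 / (r\<^sup>2 - (norm z)\<^sup>2))"
      using integral_unique[OF int] integral_unique[OF has_integral_mult_right[OF poisson_integral[OF zr(1)], of c]] by simp
    also have "\<dots> \<le> 2 * K * (r - norm z) powr (\<alpha> - real n - 1) * (2 * pi) * (1 / (r - norm z))"
    proof -
      have "r / (r\<^sup>2 - (norm z)\<^sup>2) \<le> 1 / (r - norm z)"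
        using zr add_pos_nonneg[OF zr(2) norm_ge_zero[of z]]
        by (simp add: power2_eq_square square_diff_square_factored divide_simps)
      then have "2 * K * (r - norm z) powr (\<alpha> - real n - 1) * (2 * pi) * (r / (r\<^sup>2 - (norm z)\<^sup>2))
          \<le> 2 * K * (r - norm z) powr (\<alpha> - real n - 1) * (2 * pi) * (1 / (r - norm z))"
        using K0 by (intro mult_left_mono) auto
      then show ?thesis by (simp add: c_def ac_simps)
    qed
    also have "\<dots> = 2 * K * (2 * pi) * (r - norm z) powr (\<alpha> - real (n + 2))"
    proof -
      have "(r - norm z) powr (\<alpha> - real n - 1) * (1 / (r - norm z)) = (r - norm z) powr (\<alpha> - real n - 1 - 1)"
        using zr by (subst powr_diff) auto
      then show ?thesis by (simp add: algebra_simps)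
    qed
    \<comment> \<open>Here 4 bounds 2 powr (n + 2 - \<alpha>), as \<alpha> > n; with the 2 from the
      lower bound 1 / 2 of the Blaschke power it makes the 8 of the statement.\<close>
    also have "\<dots> \<le> 2 * K * (2 * pi) * (4 * (1 - norm z) powr (\<alpha> - real (n + 2)))"
    proof -
      have "(r - norm z) powr (\<alpha> - real (n + 2)) \<le> ((1 - norm z) / 2) powr (\<alpha> - real (n + 2))"
        using rz z n by (intro powr_mono2') (auto simp: field_simps)
      also have "\<dots> = 2 powr (real (n + 2) - \<alpha>) * (1 - norm z) powr (\<alpha> - real (n + 2))"
        using z by (simp add: powr_divide powr_diff)
      also have "\<dots> \<le> 2 powr 2 * (1 - norm z) powr (\<alpha> - real (n + 2))"
        using n by (intro mult_right_mono powr_mono) auto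
      finally show ?thesis using K0 by (intro mult_left_mono) auto
    qed
    finally have "2 * pi / fact (n + 2) * norm ((deriv ^^ (n + 2)) q z)
        \<le> 2 * K * (2 * pi) * (4 * (1 - norm z) powr (\<alpha> - real (n + 2)))"
      by (simp only: norm_mult norm_divide norm_fact norm_of_real norm_ii norm_numeral) simp
    moreover have "x \<le> 8 * f * K * P" if "2 * pi / f * x \<le> 2 * K * (2 * pi) * (4 * P)" "f > 0" for x f P :: real
      using that by (simp add: field_simps)
    ultimately show ?thesis by (metis fact_gt_zero)
  qed
  show ?thesis unfolding A_bound_def
  proof (intro conjI ballI)
    fix z :: complex assume "z \<in> ball 0 1"
    then have z: "norm z < 1" by simp
    show "norm (q z) \<le> max M (8 * fact (n + 2) * K)" using qM[OF z] by simp
    have "8 * fact (n + 2) * K * (1 - norm z) powr (\<alpha> - real (n + 2))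
        \<le> max M (8 * fact (n + 2) * K) * (1 - norm z) powr (\<alpha> - real (n + 2))"
      by (intro mult_right_mono) auto
    from order_trans[OF dq[OF z] this]
    show "norm ((deriv ^^ (n + 2)) q z) \<le> max M (8 * fact (n + 2) * K) * (1 - norm z) powr (\<alpha> - real (n + 2))" .
  qed (fact q)
qed

section \<open>Consequences of free interpolation\<close>

text \<open>Baire's theorem for the Cantor space: of countably many closed sets covering it, one
  contains a cylinder. Closedness is phrased through finite prefixes, so no topology has to be set
  up.\<close>

lemma baire_bool_sequences:
  fixes X :: "nat \<Rightarrow> (nat \<Rightarrow> bool) \<Rightarrow> bool"
  assumes cover: "\<And>\<epsilon>. \<exists>M. X M \<epsilon>"
    and closed: "\<And>M \<epsilon>. (\<And>N. \<exists>\<epsilon>'. X M \<epsilon>' \<and> (\<forall>i<N. \<epsilon>' i = \<epsilon> i)) \<Longrightarrow> X M \<epsilon>"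
  shows "\<exists>M N p. \<forall>\<epsilon>. (\<forall>i<N. \<epsilon> i = p i) \<longrightarrow> X M \<epsilon>"
proof (rule ccontr)
  assume "\<not> ?thesis"
  then have neg: "\<exists>\<epsilon>. (\<forall>i<N. \<epsilon> i = p i) \<and> \<not> X M \<epsilon>" for M N :: nat and p :: "nat \<Rightarrow> bool" by blast
  \<comment> \<open>A pair (length, sequence) stands for the cylinder of that prefix. Stage M passes
    to a longer prefix whose cylinder misses \<open>X M\<close>; the limit sequence then lies in
    none of the sets.\<close>
  define Q where "Q = (\<lambda>M (x :: nat \<times> (nat \<Rightarrow> bool)) y. fst x < fst y \<and> (\<forall>i<fst x. snd y i = snd x i)
      \<and> (\<forall>\<epsilon>. (\<forall>i<fst y. \<epsilon> i = snd y i) \<longrightarrow> \<not> X M \<epsilon>))"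
  have "\<exists>f. \<forall>M. True \<and> Q M (f M) (f (Suc M))"
  proof (rule dependent_nat_choice)
    fix x M
    obtain \<epsilon> where \<epsilon>: "\<forall>i<fst x. \<epsilon> i = snd x i" "\<not> X M \<epsilon>" using neg by blast
    then obtain N where N: "\<not> (\<exists>\<epsilon>'. X M \<epsilon>' \<and> (\<forall>i<N. \<epsilon>' i = \<epsilon> i))" using closed[of M \<epsilon>] by blast
    show "\<exists>y. True \<and> Q M x y"
      by (rule exI[of _ "(max N (Suc (fst x)), \<epsilon>)"]) (use N \<epsilon> in \<open>auto simp: Q_def\<close>)
  qed auto
  then obtain f where f: "\<And>M. Q M (f M) (f (Suc M))" by blast
  have coh: "snd (f (M + m)) i = snd (f M) i" if "i < fst (f M)" for M m i
  proof (induction m)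
    case (Suc m)
    have "fst (f M) \<le> fst (f (M + m))"
      using f by (induction m) (auto simp: Q_def intro: order_trans[OF _ less_imp_le])
    then show ?case using f[of "M + m"] Suc that by (auto simp: Q_def)
  qed simp
  have ge: "M \<le> fst (f M)" for M
  proof (induction M)
    case (Suc M)
    then show ?case using f[of M] by (auto simp: Q_def)
  qed simp
  define \<epsilon> where "\<epsilon> = (\<lambda>i. snd (f (Suc i)) i)"
  have "\<epsilon> i = snd (f M) i" if "i < fst (f M)" for M i
  proof (cases "M \<le> Suc i")
    case True
    then show ?thesis using coh[OF that, of "Suc i - M"] by (simp add: \<epsilon>_def)
  next
    case False
    have "i < fst (f (Suc i))" using ge[of "Suc i"] by simp
    from coh[OF this, of "M - Suc i"] False show ?thesis by (simp add: \<epsilon>_def)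
  qed
  then have "\<not> X M \<epsilon>" for M using f[of M] by (auto simp: Q_def)
  with cover show False by blast
qed

section \<open>The zeros, their mutual distances and interpolants adapted to them\<close>

locale interpolating_blaschke_zeros =
  fixes n :: nat and \<alpha> :: real and z :: "nat \<Rightarrow> complex"
  assumes n: "real n < \<alpha>" "\<alpha> < real n + 1"
    and interpolating: "A_interpolating_blaschke n \<alpha> z"
begin

lemma norm_z [simp]: "norm (z j) < 1"
  and summable_z: "summable (\<lambda>j. 1 - norm (z j))"
  and inj_z: "inj z"
  using interpolating by (auto simp: A_interpolating_blaschke_def blaschke_seq_def)

lemma z_in_ball: "range z \<subseteq> ball 0 1"
  by auto

lemma sep_dist_le: "l \<noteq> j \<Longrightarrow> sep_dist z j \<le> norm (z j - z l)"
  unfolding sep_dist_def by (rule cINF_lower) (auto intro: bdd_belowI[of _ 0])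

text \<open>The zeros accumulate only at the circle: all but finitely many are so close to it that
  they stay at least (1 - |z j|) / 2 away from \<open>z j\<close>.\<close>

lemma sep_dist_pos: "0 < sep_dist z j"
proof -
  have "(\<lambda>l. 1 - norm (z l)) \<longlonglongrightarrow> 0" using summable_z by (rule summable_LIMSEQ_zero)
  then have "\<forall>\<^sub>F l in sequentially. 1 - norm (z l) < (1 - norm (z j)) / 2"
    by (rule order_tendstoD) simp
  then obtain N where N: "\<And>l. l \<ge> N \<Longrightarrow> 1 - norm (z l) < (1 - norm (z j)) / 2"
    unfolding eventually_sequentially by blast
  define A where "A = insert ((1 - norm (z j)) / 2) ((\<lambda>l. norm (z j - z l)) ` ({..<N} - {j}))"
  have A: "finite A" "A \<noteq> {}" "\<And>x. x \<in> A \<Longrightarrow> 0 < x"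
    using inj_z norm_z[of j] by (auto simp: A_def dest: injD simp del: norm_z)
  have "Min A \<le> norm (z j - z l)" if "l \<noteq> j" for l
  proof (cases "l < N")
    case True
    then show ?thesis using A that by (intro Min_le) (auto simp: A_def)
  next
    case False
    then have "(1 - norm (z j)) / 2 \<le> norm (z l) - norm (z j)" using N[of l] by (simp add: field_simps)
    also have "\<dots> \<le> norm (z j - z l)" by (metis norm_minus_commute norm_triangle_ineq2)
    finally show ?thesis using A(1) by (auto simp: A_def intro: order_trans[OF Min_le])
  qed
  moreover have "Suc j \<in> UNIV - {j}" by simp
  ultimately have "Min A \<le> sep_dist z j"
    unfolding sep_dist_def by (intro cINF_greatest) blast+
  then show ?thesis using A by (meson Min_in less_le_trans)
qed

text \<open>A nearest zero up to the factor 2, which spares an argument that the infimum is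
  attained.\<close>

lemma obtain_near_zero:
  obtains l where "l \<noteq> j" "norm (z j - z l) < 2 * sep_dist z j"
proof -
  have "Suc j \<in> UNIV - {j}" by simp
  then have "UNIV - {j} \<noteq> {}" by blast
  moreover have "sep_dist z j < 2 * sep_dist z j" using sep_dist_pos[of j] by simp
  ultimately obtain l where "l \<in> UNIV - {j}" "norm (z j - z l) < 2 * sep_dist z j"
    unfolding sep_dist_def by (subst (asm) cINF_less_iff) (auto intro!: bdd_belowI[of _ 0])
  then show ?thesis using that by auto
qed

lemma sep_dist_le_closure:
  assumes "w \<in> closure (range z)" "w \<noteq> z j"
  shows "sep_dist z j \<le> norm (z j - w)"
proof (rule ccontr)
  assume "\<not> ?thesis"
  \<comment> \<open>The first entry gives the contradiction, the second forces the approximating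
    zero to differ from \<open>z j\<close>.\<close>
  then have "min (sep_dist z j - norm (z j - w)) (norm (z j - w)) > 0" using assms(2) by simp
  then obtain l where "dist (z l) w < min (sep_dist z j - norm (z j - w)) (norm (z j - w))"
    using assms(1) unfolding closure_approachable by blast
  then have l: "norm (z l - w) < sep_dist z j - norm (z j - w)" "norm (z l - w) < norm (z j - w)"
    by (auto simp: dist_norm)
  then have "l \<noteq> j" by auto
  from sep_dist_le[OF this] l(1) norm_triangle_ineq4[of "z j - w" "z l - w"] show False by simp
qed

text \<open>Every other point of the closure is at distance at least \<open>sep_dist z j\<close>
  from \<open>z j\<close>, so the size of the data at either of two points is at most |v - w| powr
  (\<alpha> - k). The constant 2 arises at s = k, where both points contribute, and does not depend
  on \<open>\<epsilon>\<close>. Limit points of the zeros carry zero data.\<close>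

lemma obtain_interpolant:
  fixes \<epsilon> :: "nat \<Rightarrow> bool"
  assumes k: "k \<le> n"
  obtains g where "g \<in> A_space \<alpha>"
    "\<And>j s. s \<le> n \<Longrightarrow> (deriv ^^ s) g (z j) = (if s = k \<and> \<epsilon> j then of_real (sep_dist z j powr (\<alpha> - real k)) else 0)"
proof -
  define \<psi> :: "complex \<Rightarrow> complex" where "\<psi> = (\<lambda>w. if w \<in> z ` Collect \<epsilon> then of_real (sep_dist z (inv z w) powr (\<alpha> - real k)) else 0)"
  define \<phi> where "\<phi> = (\<lambda>s w. if s = k then \<psi> w else 0)"
  let ?E = "closure (range z)"
  have \<psi>_le: "norm (\<psi> w) \<le> norm (v - w) powr (\<alpha> - real k)" if "v \<in> ?E" "v \<noteq> w" for v w
  proof (cases "w \<in> z ` Collect \<epsilon>")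
    case True
    then obtain j where j: "w = z j" by auto
    have "sep_dist z j powr (\<alpha> - real k) \<le> norm (z j - v) powr (\<alpha> - real k)"
      using sep_dist_le_closure[of v j] that j sep_dist_pos[of j] k n by (intro powr_mono2) auto
    with True show ?thesis using inj_z by (simp add: \<psi>_def j norm_minus_commute)
  qed (simp add: \<psi>_def)
  have "jet_condition n \<alpha> ?E \<phi>" unfolding jet_condition_def
  proof (intro exI[of _ 2] conjI ballI allI impI)
    fix v w s assume v: "v \<in> ?E" and w: "w \<in> ?E" and s: "s \<le> n"
    have sum: "(\<Sum>m=0..n-s. \<phi> (s + m) w / fact m * (v - w) ^ m)
        = (if s \<le> k then \<psi> w / fact (k - s) * (v - w) ^ (k - s) else 0)"
    proof -
      have "(\<Sum>m=0..n-s. \<phi> (s + m) w / fact m * (v - w) ^ m)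
          = (\<Sum>m\<in>(if s \<le> k then {k - s} else {}). \<phi> (s + m) w / fact m * (v - w) ^ m)"
        using k s by (intro sum.mono_neutral_right) (auto simp: \<phi>_def split: if_splits)
      then show ?thesis by (auto simp: \<phi>_def)
    qed
    show "norm (\<phi> s v - (\<Sum>m=0..n-s. \<phi> (s + m) w / fact m * (v - w) ^ m)) \<le> 2 * norm (v - w) powr (\<alpha> - real s)"
    proof (cases "v = w")
      case True
      then show ?thesis unfolding sum by (cases "s = k") (auto simp: \<phi>_def)
    next
      case False
      have 1: "norm (\<psi> w) \<le> norm (v - w) powr (\<alpha> - real k)" using \<psi>_le[OF v False] .
      have 2: "norm (\<psi> v) \<le> norm (v - w) powr (\<alpha> - real k)"
        using \<psi>_le[OF w False[symmetric]] by (simp add: norm_minus_commute)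
      consider "s = k" | "s < k" | "s > k" by linarith
      then show ?thesis
      proof cases
        case 1
        then show ?thesis unfolding sum using norm_triangle_ineq4[of "\<psi> v" "\<psi> w"] \<open>norm (\<psi> w) \<le> _\<close> 2
          by (simp add: \<phi>_def)
      next
        case 2
        have "norm (\<psi> w / fact (k - s) * (v - w) ^ (k - s)) \<le> norm (\<psi> w) / 1 * norm (v - w) ^ (k - s)"
          unfolding norm_mult norm_divide norm_power norm_fact by (intro mult_right_mono divide_left_mono) (auto simp: fact_ge_1)
        also have "\<dots> \<le> norm (v - w) powr (\<alpha> - real k) * norm (v - w) ^ (k - s)"
          using 1 by (intro mult_right_mono) auto
        also have "\<dots> = norm (v - w) powr (\<alpha> - real s)"
          using False 2 by (simp add: powr_realpow[symmetric] powr_add[symmetric] of_nat_diff)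
        also have "\<dots> \<le> 2 * norm (v - w) powr (\<alpha> - real s)" by simp
        finally show ?thesis unfolding sum using 2 by (simp add: \<phi>_def)
      qed (simp add: sum, simp add: \<phi>_def)
    qed
  qed simp
  then obtain g where g: "g \<in> A_space \<alpha>"
      and G: "\<And>s. s \<le> n \<Longrightarrow> \<exists>G. extends_to_closed_disc ((deriv ^^ s) g) G \<and> (\<forall>w\<in>?E. G w = \<phi> s w)"
    using interpolating unfolding A_interpolating_blaschke_def A_interpolating_set_def by blast
  have "(deriv ^^ s) g (z j) = (if s = k \<and> \<epsilon> j then of_real (sep_dist z j powr (\<alpha> - real k)) else 0)" if s: "s \<le> n" for j s
  proof -
    obtain H where H: "extends_to_closed_disc ((deriv ^^ s) g) H" "\<forall>w\<in>?E. H w = \<phi> s w" using G[OF s] by blast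
    have "(deriv ^^ s) g (z j) = H (z j)" using H(1) by (simp add: extends_to_closed_disc_def)
    also have "\<dots> = \<phi> s (z j)" using H(2) closure_subset[of "range z"] by blast
    also have "\<dots> = (if s = k \<and> \<epsilon> j then of_real (sep_dist z j powr (\<alpha> - real k)) else 0)"
      using inj_z by (auto simp: \<phi>_def \<psi>_def inj_image_mem_iff)
    finally show ?thesis .
  qed
  with g that show ?thesis by blast
qed

text \<open>The height \<open>sep_dist z j powr \<alpha>\<close> is the natural scale: by Taylor's
  formula at a nearby zero, where all jets vanish, \<open>g (z j)\<close> is at most a multiple of
  it.\<close>

definition spike :: "real \<Rightarrow> nat \<Rightarrow> (complex \<Rightarrow> complex) \<Rightarrow> bool" where
  "spike M j g \<longleftrightarrow> A_bound (Suc n) \<alpha> M g \<and>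
     (\<forall>l s. s \<le> n \<longrightarrow> (deriv ^^ s) g (z l) = (if s = 0 \<and> l = j then of_real (sep_dist z j powr \<alpha>) else 0))"

text \<open>The uniform bound comes from Baire's theorem on the Cantor space of all choices of the zeros
  that carry a nonzero value, with closedness provided by Montel's theorem.\<close>

lemma uniform_spikes: "\<exists>M\<ge>1. \<forall>j. \<exists>g. spike M j g"
proof -
  define P where "P = (\<lambda>\<epsilon> g. \<forall>j s. s \<le> n \<longrightarrow>
      (deriv ^^ s) g (z j) = (if s = 0 \<and> \<epsilon> j then of_real (sep_dist z j powr \<alpha>) else 0))"
  define X where "X = (\<lambda>(M::nat) \<epsilon>. \<exists>g. A_bound (Suc n) \<alpha> (real M) g \<and> P \<epsilon> g)"
  have cover: "\<exists>M. X M \<epsilon>" for \<epsilon>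
  proof -
    obtain g where g: "g \<in> A_space \<alpha>" "P \<epsilon> g"
      using obtain_interpolant[of 0 \<epsilon>] unfolding P_def by (metis (no_types, lifting) diff_zero le0 of_nat_0)
    then obtain M where "A_bound (Suc n) \<alpha> M g"
      using A_space_imp_A_bound[of g \<alpha> "Suc n"] n by auto
    then have "A_bound (Suc n) \<alpha> (real (nat \<lceil>M\<rceil>)) g" by (rule A_bound_mono) linarith
    with g show ?thesis unfolding X_def by blast
  qed
  \<comment> \<open>The N-th approximant has the right jets at the first N zeros; at a fixed zero
    its jets are thus eventually constant along the sequence and pass to the Montel limit.\<close>
  have closed: "X M \<epsilon>" if app: "\<And>N. \<exists>\<epsilon>'. X M \<epsilon>' \<and> (\<forall>i<N. \<epsilon>' i = \<epsilon> i)" for M \<epsilon>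
  proof -
    have "\<exists>g. A_bound (Suc n) \<alpha> (real M) g \<and> (\<forall>j<N. \<forall>s\<le>n.
        (deriv ^^ s) g (z j) = (if s = 0 \<and> \<epsilon> j then of_real (sep_dist z j powr \<alpha>) else 0))" for N
    proof -
      from app[of N] obtain \<epsilon>' g where \<epsilon>': "\<forall>i<N. \<epsilon>' i = \<epsilon> i" "A_bound (Suc n) \<alpha> (real M) g" "P \<epsilon>' g"
        unfolding X_def by blast
      show ?thesis by (rule exI[of _ g]) (use \<epsilon>' in \<open>simp add: P_def\<close>)
    qed
    then have "\<forall>N. \<exists>g. A_bound (Suc n) \<alpha> (real M) g \<and> (\<forall>j<N. \<forall>s\<le>n.
        (deriv ^^ s) g (z j) = (if s = 0 \<and> \<epsilon> j then of_real (sep_dist z j powr \<alpha>) else 0))" by (rule allI)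
    from choice[OF this] obtain g where "\<forall>N. A_bound (Suc n) \<alpha> (real M) (g N) \<and> (\<forall>j<N. \<forall>s\<le>n.
        (deriv ^^ s) (g N) (z j) = (if s = 0 \<and> \<epsilon> j then of_real (sep_dist z j powr \<alpha>) else 0))" by (rule exE)
    then have g: "A_bound (Suc n) \<alpha> (real M) (g N)" "j < N \<Longrightarrow> s \<le> n \<Longrightarrow>
        (deriv ^^ s) (g N) (z j) = (if s = 0 \<and> \<epsilon> j then of_real (sep_dist z j powr \<alpha>) else 0)" for N j s by blast+
    obtain h r where h: "A_bound (Suc n) \<alpha> (real M) h" "strict_mono (r :: nat \<Rightarrow> nat)"
      "\<And>s w. norm w < 1 \<Longrightarrow> (\<lambda>i. (deriv ^^ s) (g (r i)) w) \<longlonglongrightarrow> (deriv ^^ s) h w"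
      by (rule A_bound_convergent_subseq[of "Suc n" \<alpha> "real M" g, OF g(1)]) (rule that)
    have "P \<epsilon> h" unfolding P_def
    proof (intro allI impI)
      fix j s assume s: "s \<le> n"
      have "\<forall>\<^sub>F i in sequentially. (deriv ^^ s) (g (r i)) (z j)
          = (if s = 0 \<and> \<epsilon> j then of_real (sep_dist z j powr \<alpha>) else 0)"
        using eventually_gt_at_top[of j]
      proof eventually_elim
        case (elim i)
        then have "j < r i" using seq_suble[OF h(2), of i] by simp
        then show ?case by (rule g(2)[OF _ s])
      qed
      then have "(\<lambda>i. (deriv ^^ s) (g (r i)) (z j))
          \<longlonglongrightarrow> (if s = 0 \<and> \<epsilon> j then of_real (sep_dist z j powr \<alpha>) else 0)"
        by (rule tendsto_eventually)
      then show "(deriv ^^ s) h (z j) = (if s = 0 \<and> \<epsilon> j then of_real (sep_dist z j powr \<alpha>) else 0)"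
        by (rule LIMSEQ_unique[OF h(3)[OF norm_z]])
    qed
    with h(1) show ?thesis unfolding X_def by blast
  qed
  obtain M N p where p: "\<And>\<epsilon>. (\<And>i. i < N \<Longrightarrow> \<epsilon> i = p i) \<Longrightarrow> X M \<epsilon>"
    using baire_bool_sequences[of X, OF cover closed] by blast
  have diff: "spike (real M + real M') j (\<lambda>w. g w - h w)"
    if g: "A_bound (Suc n) \<alpha> (real M) g" "P \<epsilon> g" and h: "A_bound (Suc n) \<alpha> (real M') h" "P \<epsilon>' h"
      and \<epsilon>: "\<And>l. \<epsilon> l = (\<epsilon>' l \<or> l = j)" "\<not> \<epsilon>' j" for M M' :: nat and g h j \<epsilon> \<epsilon>'
  proof -
    note G = A_boundD[OF g(1)] and H = A_boundD[OF h(1)]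
    have d: "(deriv ^^ s) (\<lambda>w. g w - h w) w = (deriv ^^ s) g w - (deriv ^^ s) h w" if "norm w < 1" for s w
      using G(1) H(1) that by (intro higher_deriv_diff[of _ "ball 0 1"]) auto
    have "A_bound (Suc n) \<alpha> (real M + real M') (\<lambda>w. g w - h w)"
      unfolding A_bound_def
    proof (intro conjI ballI)
      fix w :: complex assume "w \<in> ball 0 1"
      then have w: "norm w < 1" by simp
      show "norm (g w - h w) \<le> real M + real M'"
        using G(2)[OF w] H(2)[OF w] norm_triangle_ineq4[of "g w" "h w"] by linarith
      show "norm ((deriv ^^ Suc n) (\<lambda>w. g w - h w) w) \<le> (real M + real M') * (1 - norm w) powr (\<alpha> - real (Suc n))"
        unfolding d[OF w] distrib_right
        using G(3)[OF w] H(3)[OF w] norm_triangle_ineq4[of "(deriv ^^ Suc n) g w" "(deriv ^^ Suc n) h w"] by linarith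
    qed (use G(1) H(1) in \<open>auto intro: holomorphic_intros\<close>)
    moreover have "(deriv ^^ s) (\<lambda>w. g w - h w) (z l) = (if s = 0 \<and> l = j then of_real (sep_dist z j powr \<alpha>) else 0)"
      if "s \<le> n" for l s
      using g(2) h(2) \<epsilon> that unfolding d[OF norm_z] P_def by (cases "l = j") auto
    ultimately show ?thesis unfolding spike_def by blast
  qed
  \<comment> \<open>Coordinates from N on are free in the cylinder, so the pattern supported in the
    prefix belongs to \<open>X M\<close> both with and without \<open>j\<close>.\<close>
  have tail: "\<exists>g. spike (real M + real M) j g" if "j \<ge> N" for j
  proof -
    have "X M (\<lambda>l. (l < N \<and> p l) \<or> l = j)" "X M (\<lambda>l. l < N \<and> p l)" using that by (auto intro!: p)
    then obtain g h where "A_bound (Suc n) \<alpha> (real M) g" "P (\<lambda>l. (l < N \<and> p l) \<or> l = j) g"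
      "A_bound (Suc n) \<alpha> (real M) h" "P (\<lambda>l. l < N \<and> p l) h" unfolding X_def by blast
    from diff[OF this, of j] show ?thesis using that by auto
  qed
  \<comment> \<open>For the finitely many j < N individual constants suffice; \<open>K\<close> below
    is their maximum with the constant for the tail.\<close>
  have "\<exists>M'::real. \<exists>g. spike M' j g" for j
  proof -
    obtain M1 M2 where "X M1 (\<lambda>l. l = j)" "X M2 (\<lambda>l. False)" using cover by blast
    then obtain g h where "A_bound (Suc n) \<alpha> (real M1) g" "P (\<lambda>l. l = j) g"
      "A_bound (Suc n) \<alpha> (real M2) h" "P (\<lambda>l. False) h" unfolding X_def by blast
    from diff[OF this, of j] show ?thesis by auto
  qed
  then obtain m where m: "\<And>j. \<exists>g. spike (m j) j g" by metis
  define K where "K = Max (insert 1 (insert (real M + real M) (m ` {..<N})))"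
  have K: "x \<le> K" if "x \<in> insert 1 (insert (real M + real M) (m ` {..<N}))" for x
    unfolding K_def using that by (intro Max_ge) auto
  have mono: "spike M1 j g \<Longrightarrow> M1 \<le> M2 \<Longrightarrow> spike M2 j g" for M1 M2 j g
    using A_bound_mono unfolding spike_def by blast
  have "\<exists>g. spike K j g" for j
  proof (cases "j < N")
    case True
    then have "m j \<le> K" by (intro K) auto
    with m mono show ?thesis by blast
  next
    case False
    then have "\<exists>g. spike (real M + real M) j g" using tail by simp
    moreover have "real M + real M \<le> K" by (rule K) simp
    ultimately show ?thesis using mono by blast
  qed
  moreover have "1 \<le> K" by (rule K) simp
  ultimately show ?thesis by blast
qed

text \<open>The Hoelder form of Taylor's estimate would only give back d powr \<alpha> <= const * d
  powr \<alpha>. If the neighbour \<open>z l\<close> lies within \<rho> = (1 - |z j|) / 2, the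
  derivative of order n + 1 is at most M \<rho> powr (- a) nearby, with a = n + 1 - \<alpha>; this
  gains a factor d powr a and yields \<rho> powr a <= const * d powr a.\<close>

lemma sep_dist_ge: "\<exists>c>0. \<forall>j. c * (1 - norm (z j)) \<le> sep_dist z j"
proof -
  obtain M where M: "M \<ge> 1" "\<And>j. \<exists>g. spike M j g" using uniform_spikes by blast
  define a where "a = real n + 1 - \<alpha>"
  have a: "0 < a" using n by (simp add: a_def)
  \<comment> \<open>The 4 is for a neighbour farther than \<rho>; the other entry solves \<rho> powr
    a <= M * 2 ^ (n + 1) * d powr a, with 2 for passing from \<rho> to 1 - |z j|.\<close>
  define C where "C = max 4 (2 * (M * 2 ^ Suc n) powr (1 / a))"
  have "1 - norm (z j) \<le> C * sep_dist z j" for j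
  proof -
    obtain g where g: "spike M j g" using M by blast
    then have Ag: "A_bound (Suc n) \<alpha> M g" by (simp add: spike_def)
    note D = A_boundD[OF Ag]
    obtain l where l: "l \<noteq> j" "norm (z j - z l) < 2 * sep_dist z j" by (rule obtain_near_zero)
    define d where "d = sep_dist z j"
    define \<rho> where "\<rho> = (1 - norm (z j)) / 2"
    have d: "0 < d" and \<rho>: "0 < \<rho>" using sep_dist_pos by (auto simp: d_def \<rho>_def)
    show ?thesis
    proof (cases "\<rho> \<le> norm (z j - z l)")
      case True
      then have "1 - norm (z j) \<le> 4 * d" using l by (simp add: \<rho>_def d_def field_simps)
      also have "\<dots> \<le> C * d" using d by (intro mult_right_mono) (auto simp: C_def)
      finally show ?thesis by (simp add: d_def)
    next
      case False
      have far: "\<rho> \<le> 1 - norm u" if "u \<in> cball (z j) \<rho>" for u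
        using that norm_triangle_ineq3[of u "z j"] by (simp add: dist_norm norm_minus_commute \<rho>_def abs_le_iff field_simps)
      have u1: "norm u < 1" if "u \<in> cball (z j) \<rho>" for u using far[OF that] \<rho> by linarith
      have "norm ((deriv ^^ 0) g (z j) - (\<Sum>i\<le>n. (deriv ^^ i) g (z l) * (z j - z l) ^ i / fact i))
          \<le> M * \<rho> powr (- a) * norm (z j - z l) ^ Suc n / fact n"
      proof (rule complex_Taylor[where S = "cball (z j) \<rho>" and f = "\<lambda>i. (deriv ^^ i) g"])
        fix i u assume u: "u \<in> cball (z j) \<rho>"
        show "((deriv ^^ i) g has_field_derivative (deriv ^^ Suc i) g u) (at u within cball (z j) \<rho>)"
          using D(1) u1[OF u] by (auto intro!: holomorphic_derivI[of _ "ball 0 1"] holomorphic_higher_deriv)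
        have "norm ((deriv ^^ Suc n) g u) \<le> M * (1 - norm u) powr (\<alpha> - real (Suc n))"
          by (rule D(3)[OF u1[OF u]])
        also have "\<dots> \<le> M * \<rho> powr (\<alpha> - real (Suc n))"
          using far[OF u] \<rho> M n by (intro mult_left_mono powr_mono2') auto
        finally show "norm ((deriv ^^ Suc n) g u) \<le> M * \<rho> powr (- a)" by (simp add: a_def algebra_simps)
      qed (use False \<rho> in \<open>auto simp: dist_norm\<close>)
      moreover have "(\<Sum>i\<le>n. (deriv ^^ i) g (z l) * (z j - z l) ^ i / fact i) = 0"
        using g l(1) by (intro sum.neutral) (auto simp: spike_def)
      moreover have "g (z j) = of_real (d powr \<alpha>)"
      proof -
        have "(deriv ^^ 0) g (z j) = of_real (d powr \<alpha>)" using g by (simp only: spike_def d_def) auto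
        then show ?thesis by simp
      qed
      ultimately have "d powr \<alpha> \<le> M * \<rho> powr (- a) * norm (z j - z l) ^ Suc n / fact n" using d by simp
      also have "\<dots> \<le> M * \<rho> powr (- a) * (2 * d) ^ Suc n / 1"
        using M l d by (intro frac_le mult_left_mono power_mono) (auto simp: d_def fact_ge_1)
      also have "\<dots> = M * 2 ^ Suc n * \<rho> powr (- a) * d powr real (Suc n)"
        using d by (simp add: powr_realpow power_mult_distrib del: power_Suc of_nat_Suc)
      finally have "d powr \<alpha> \<le> M * 2 ^ Suc n * \<rho> powr (- a) * (d powr \<alpha> * d powr a)"
        by (simp add: powr_add[symmetric] a_def add.commute)
      then have "\<rho> powr a \<le> M * 2 ^ Suc n * d powr a"
        using d \<rho> by (simp add: powr_minus field_simps)
      then have "(\<rho> powr a) powr (1 / a) \<le> (M * 2 ^ Suc n * d powr a) powr (1 / a)"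
        using a by (intro powr_mono2) auto
      then have "\<rho> \<le> (M * 2 ^ Suc n) powr (1 / a) * d"
        using a \<rho> d M by (simp add: powr_mult powr_powr del: power_Suc)
      then have "1 - norm (z j) \<le> 2 * (M * 2 ^ Suc n) powr (1 / a) * d" by (simp add: \<rho>_def field_simps)
      also have "\<dots> \<le> C * d" using d by (intro mult_right_mono) (auto simp: C_def)
      finally show ?thesis by (simp add: d_def)
    qed
  qed
  moreover have "C > 0" by (simp add: C_def)
  ultimately show ?thesis by (intro exI[of _ "1 / C"]) (auto simp: field_simps)
qed

text \<open>Dividing a spike \<open>g\<close> by \<open>(w - p)\<^sup>n\<^sup>+\<^sup>1\<close>, with \<open>p\<close> outside the disc at distance about \<open>d\<^sub>j\<close> from
  \<open>z\<^sub>j\<close>, localises the sup-norm bound of \<open>g\<close> to the scale \<open>d\<^sub>j\<close>.\<close>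

lemma uniformly_separated:
  "\<exists>c>0. \<forall>j S. finite S \<longrightarrow> S \<subseteq> range z - {z j} \<longrightarrow> c \<le> norm (fin_blaschke S (z j))"
proof -
  obtain M where M: "M \<ge> 1" "\<And>j. \<exists>g. spike M j g" using uniform_spikes by blast
  obtain c where c: "c > 0" "\<And>j. c * (1 - norm (z j)) \<le> sep_dist z j" using sep_dist_ge by blast
  \<comment> \<open>From |w - z l| <= |w - p| + |p - z j| + |z j - z l| with |p - z j| <= (1 + 1 /
    c) d, |z j - z l| < 2 d and d <= |w - p|.\<close>
  define A where "A = 4 + 1 / c"
  have A: "A > 0" using c by (auto simp: A_def intro!: add_pos_pos)
  define K where "K = (2 / (\<alpha> - real n) + 1) * M"
  have "0 < 2 / (\<alpha> - real n) + 1" using n by (auto intro!: add_pos_pos)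
  then have K: "K > 0" using M(1) by (simp add: K_def)
  define L where "L = K * A powr \<alpha> * A ^ Suc n"
  have L: "L > 0" using K A by (simp add: L_def)
  have "1 / L \<le> norm (fin_blaschke S (z j))" if S: "finite S" "S \<subseteq> range z - {z j}" for j S
  proof -
    obtain g where g: "spike M j g" using M by blast
    then have Ag: "A_bound (Suc n) \<alpha> M g" by (simp add: spike_def)
    note D = A_boundD[OF Ag]
    have jets: "(deriv ^^ s) g (z l) = 0" if "s \<le> n" "l \<noteq> j" for s l using g that by (simp add: spike_def)
    obtain l where l: "l \<noteq> j" "norm (z j - z l) < 2 * sep_dist z j" by (rule obtain_near_zero)
    define d where "d = sep_dist z j"
    have d: "0 < d" using sep_dist_pos by (simp add: d_def)
    have cd: "1 - norm (z j) \<le> d / c" using c by (simp add: d_def field_simps)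
    \<comment> \<open>\<open>e\<close> is the direction of \<open>z j\<close>, with default 1 at the
      origin; \<open>p\<close> lies on that ray at distance d beyond the circle.\<close>
    define e where "e = (if z j = 0 then 1 else sgn (z j))"
    have e: "norm e = 1" "z j = of_real (norm (z j)) * e"
      by (simp_all add: e_def norm_sgn) (simp add: sgn_div_norm scaleR_conv_of_real)
    define p where "p = of_real (1 + d) * e"
    have np: "norm p = 1 + d" using d e by (simp add: p_def norm_mult del: of_real_add)
    have pz: "norm (p - z j) = 1 + d - norm (z j)"
    proof -
      have "p - z j = of_real (1 + d - norm (z j)) * e" unfolding p_def by (subst (1) e(2)) (simp add: algebra_simps)
      moreover have "0 \<le> 1 + d - norm (z j)" using d norm_z[of j] by linarith
      ultimately show ?thesis using e(1) by (simp only: norm_mult norm_of_real) simp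
    qed
    have wp: "d \<le> norm (w - p)" if "norm w < 1" for w
      using norm_triangle_ineq2[of p w] np that by (simp add: norm_minus_commute)
    have zl: "norm (w - z l) \<le> A * norm (w - p)" if w: "norm w < 1" for w
    proof -
      have "norm (w - z l) \<le> norm (w - p) + norm (p - z j) + norm (z j - z l)"
        using norm_triangle_ineq[of "w - p" "p - z j"] norm_triangle_ineq[of "w - z j" "z j - z l"] by simp
      also have "\<dots> \<le> norm (w - p) + (3 + 1 / c) * d"
        using pz cd l(2) by (simp add: d_def algebra_simps)
      also have "\<dots> \<le> norm (w - p) + (3 + 1 / c) * norm (w - p)"
        using wp[OF w] c by (intro add_left_mono mult_left_mono) auto
      finally show ?thesis by (simp add: A_def algebra_simps)
    qed
    define F where "F = (\<lambda>w. g w / (w - p) ^ Suc n)"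
    have p0: "w - p \<noteq> 0" if "norm w < 1" for w using wp[OF that] d by auto
    have F: "F holomorphic_on ball 0 1" unfolding F_def using D(1) p0 by (intro holomorphic_intros) auto
    \<comment> \<open>Flatness of \<open>g\<close> at \<open>z l\<close> gives the power \<alpha> of
      |w - p|, short of the n + 1 in the denominator; the resulting negative exponent makes |w - p|
      = d the worst case.\<close>
    have Fle: "norm (F w) \<le> K * A powr \<alpha> * d powr (\<alpha> - real (Suc n))" if w: "norm w < 1" for w
    proof -
      have "norm ((deriv ^^ 0) g w - (\<Sum>m=0..n-0. (deriv ^^ (0 + m)) g (z l) / fact m * (w - z l) ^ m))
          \<le> K * norm (w - z l) powr (\<alpha> - real 0)"
        unfolding K_def by (rule A_bound_taylor[OF n Ag norm_z w]) simp
      moreover have "(\<Sum>m=0..n-0. (deriv ^^ (0 + m)) g (z l) / fact m * (w - z l) ^ m) = 0"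
        using jets l(1) by (intro sum.neutral) auto
      ultimately have "norm (g w) \<le> K * norm (w - z l) powr \<alpha>" by simp
      also have "\<dots> \<le> K * (A * norm (w - p)) powr \<alpha>"
        using zl[OF w] K n by (intro mult_left_mono powr_mono2) auto
      also have "\<dots> = K * A powr \<alpha> * norm (w - p) powr \<alpha>" using A by (simp add: powr_mult)
      finally have "norm (F w) \<le> K * A powr \<alpha> * (norm (w - p) powr \<alpha> / norm (w - p) ^ Suc n)"
        using p0[OF w] by (simp add: F_def norm_divide norm_power divide_right_mono del: power_Suc)
      also have "norm (w - p) powr \<alpha> / norm (w - p) ^ Suc n = norm (w - p) powr (\<alpha> - real (Suc n))"
        using p0[OF w] by (simp add: powr_diff powr_realpow[symmetric] del: power_Suc of_nat_Suc)
      also have "K * A powr \<alpha> * \<dots> \<le> K * A powr \<alpha> * d powr (\<alpha> - real (Suc n))"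
        using wp[OF w] d n K by (intro mult_left_mono powr_mono2') auto
      finally show ?thesis .
    qed
    have SD: "S \<subseteq> ball 0 1" using S z_in_ball by blast
    have "(deriv ^^ i) F a = 0" if a: "a \<in> S" "i < 1" for a i
    proof -
      obtain l' where "a = z l'" "l' \<noteq> j" using S(2) a by auto
      then show ?thesis using jets[of 0 l'] a by (simp add: F_def)
    qed
    then obtain q where q: "q holomorphic_on ball 0 1" "\<And>w. norm w < 1 \<Longrightarrow> F w = q w * fin_blaschke S w ^ 1"
      using holomorphic_factor_fin_blaschke[OF F S(1) SD, of 1] by metis
    have "norm (q (z j)) \<le> K * A powr \<alpha> * d powr (\<alpha> - real (Suc n))"
      using bound_divide_fin_blaschke[OF SD q(1), of 1 _ "z j"] q(2) Fle by (metis norm_z)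
    then have "norm (F (z j)) \<le> K * A powr \<alpha> * d powr (\<alpha> - real (Suc n)) * norm (fin_blaschke S (z j))"
      using q(2)[OF norm_z, of j] by (simp add: norm_mult mult_right_mono)
    \<comment> \<open>At \<open>z j\<close> the function \<open>F\<close> reaches its global bound
      up to the factor 1 / L. Since the quotient \<open>q\<close> obeys that same bound, the
      Blaschke product cannot be small there.\<close>
    moreover have "d powr \<alpha> / (A * d) ^ Suc n \<le> norm (F (z j))"
    proof -
      have "(deriv ^^ 0) g (z j) = of_real (d powr \<alpha>)" using g by (simp only: spike_def d_def) auto
      then have "norm (F (z j)) = d powr \<alpha> / norm (p - z j) ^ Suc n"
        by (simp add: F_def norm_divide norm_power norm_minus_commute norm_mult)
      moreover have "norm (p - z j) \<le> A * d"
        using pz cd d by (simp add: A_def algebra_simps)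
      moreover have "0 < norm (p - z j)" using pz d norm_z[of j] by linarith
      ultimately show ?thesis using A d by (simp add: divide_left_mono power_mono del: power_Suc)
    qed
    ultimately have "d powr \<alpha> / (A * d) ^ Suc n
        \<le> K * A powr \<alpha> * (d powr \<alpha> / d ^ Suc n) * norm (fin_blaschke S (z j))"
      using d by (simp add: powr_diff powr_realpow[symmetric] del: power_Suc of_nat_Suc)
    then show ?thesis
      using d A K L by (simp add: L_def power_mult_distrib field_simps del: power_Suc)
  qed
  then show ?thesis using L by (intro exI[of _ "1 / L"]) auto
qed

end

section \<open>Boundary growth at the zeros\<close>

lemma norm_blaschke_factor_minus_1_le:
  assumes a: "norm a < 1" and w: "norm w < 1"
  shows "norm (blaschke_factor a w - 1) \<le> (1 - norm a) * ((1 + norm w) / (1 - norm w))"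
proof (cases "a = 0")
  case True
  have "1 * (1 + norm w) \<le> (1 + norm w) / (1 - norm w)"
    using w by (simp add: field_simps)
  then show ?thesis using True norm_triangle_ineq4[of w 1] by (simp add: blaschke_factor_def)
next
  case False
  have nz: "1 - cnj a * w \<noteq> 0" using one_minus_cnj_mult_nonzero[OF a, of w] w by simp
  have aw: "norm a * norm w \<le> norm w" using a by (intro mult_left_le_one_le) auto
  have "cnj a * a = of_real (norm a) * of_real (norm a)"
    using complex_norm_square[of a] by (simp add: power2_eq_square mult.commute)
  then have "of_real (norm a) * (1 - cnj a * w) * (blaschke_factor a w - 1)
      = - of_real (1 - norm a) * (of_real (norm a) + cnj a * w)"
    using False nz by (simp add: blaschke_factor_def field_simps)
  then have "norm (of_real (norm a) * (1 - cnj a * w) * (blaschke_factor a w - 1))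
      = norm (- of_real (1 - norm a) * (of_real (norm a) + cnj a * w))" by simp
  then have "norm a * norm (1 - cnj a * w) * norm (blaschke_factor a w - 1)
      = (1 - norm a) * norm (of_real (norm a) + cnj a * w)"
    using a by (simp only: norm_mult norm_minus_cancel norm_of_real) simp
  also have "\<dots> \<le> (1 - norm a) * (norm a * (1 + norm w))"
    using a norm_triangle_ineq[of "of_real (norm a)" "cnj a * w"]
    by (intro mult_left_mono) (auto simp: norm_mult algebra_simps)
  finally have "norm (1 - cnj a * w) * norm (blaschke_factor a w - 1) \<le> (1 - norm a) * (1 + norm w)"
    using False by (simp add: mult.assoc mult.left_commute)
  moreover have "1 - norm w \<le> norm (1 - cnj a * w)"
    using norm_triangle_ineq2[of 1 "cnj a * w"] aw by (simp add: norm_mult)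
  ultimately have "(1 - norm w) * norm (blaschke_factor a w - 1) \<le> (1 - norm a) * (1 + norm w)"
    by (meson mult_right_mono norm_ge_zero order_trans)
  then show ?thesis using w by (simp add: field_simps)
qed

lemma tendsto_blaschke_product:
  assumes "blaschke_seq z" and w: "norm w < 1"
  shows "(\<lambda>N. \<Prod>i<N. blaschke_factor (z i) w) \<longlonglongrightarrow> blaschke_product z w"
proof -
  have z: "\<And>j. norm (z j) < 1" "summable (\<lambda>j. 1 - norm (z j))"
    using assms(1) by (auto simp: blaschke_seq_def)
  have "summable (\<lambda>i. norm (blaschke_factor (z i) w - 1))"
    by (rule summable_comparison_test'[OF summable_mult2[OF z(2), of "(1 + norm w) / (1 - norm w)"], of 0])
       (use norm_blaschke_factor_minus_1_le[OF z(1) w] in simp)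
  then have "convergent_prod (\<lambda>i. blaschke_factor (z i) w)"
    by (intro abs_convergent_prod_imp_convergent_prod) (simp add: abs_convergent_prod_conv_summable)
  from convergent_prod_LIMSEQ[OF this]
  have "(\<lambda>N. \<Prod>i<Suc N. blaschke_factor (z i) w) \<longlonglongrightarrow> blaschke_product z w"
    by (simp add: blaschke_product_def lessThan_Suc_atMost)
  then show ?thesis by (rule LIMSEQ_imp_Suc)
qed

section \<open>Linear algebra for the elimination in (a)\<close>

lemma prod_linear_eq_sum_gbinomial:
  "\<exists>a. \<forall>x::real. (\<Prod>t=1..N. c + real t - x) = (\<Sum>s\<le>N. a s * (x gchoose s))"
proof (induction N)
  case 0
  show ?case by (rule exI[of _ "\<lambda>_. 1"]) simp
next
  case (Suc N)
  then obtain a where a: "\<And>x. (\<Prod>t=1..N. c + real t - x) = (\<Sum>s\<le>N. a s * (x gchoose s))" by blast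
  define e where "e = c + real (Suc N)"
  \<comment> \<open>Multiply the previous expansion by e - x and use x * (x gchoose s) = s * (x
    gchoose s) + (s + 1) * (x gchoose (s + 1)).\<close>
  define b where "b = (\<lambda>s. (if s \<le> N then a s * (e - real s) else 0) - (if s = 0 then 0 else a (s - 1) * real s))"
  have "(\<Prod>t=1..Suc N. c + real t - x) = (\<Sum>s\<le>Suc N. b s * (x gchoose s))" for x
  proof -
    have "(\<Sum>s\<le>Suc N. b s * (x gchoose s))
        = (\<Sum>s\<le>Suc N. if s \<le> N then a s * (e - real s) * (x gchoose s) else 0)
          - (\<Sum>s\<le>Suc N. if s = 0 then 0 else a (s - 1) * real s * (x gchoose s))"
      unfolding sum_subtractf[symmetric] by (intro sum.cong) (auto simp: b_def algebra_simps)
    also have "(\<Sum>s\<le>Suc N. if s \<le> N then a s * (e - real s) * (x gchoose s) else 0)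
        = (\<Sum>s\<le>N. a s * (e - real s) * (x gchoose s))" by simp
    also have "(\<Sum>s\<le>Suc N. if s = 0 then 0 else a (s - 1) * real s * (x gchoose s))
        = (\<Sum>s\<le>N. a s * real (Suc s) * (x gchoose Suc s))"
      by (subst sum.atMost_Suc_shift) simp
    also have "(\<Sum>s\<le>N. a s * (e - real s) * (x gchoose s)) - (\<Sum>s\<le>N. a s * real (Suc s) * (x gchoose Suc s))
        = (\<Sum>s\<le>N. (e - x) * (a s * (x gchoose s)))"
      unfolding sum_subtractf[symmetric]
    proof (intro sum.cong refl)
      fix s
      have "a s * (x * (x gchoose s)) = a s * (real s * (x gchoose s) + real (Suc s) * (x gchoose Suc s))"
        by (simp only: gbinomial_mult_1)
      then show "a s * (e - real s) * (x gchoose s) - a s * real (Suc s) * (x gchoose Suc s)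
          = (e - x) * (a s * (x gchoose s))" by (simp only: algebra_simps)
    qed
    also have "\<dots> = (\<Prod>t=1..Suc N. c + real t - x)"
      unfolding sum_distrib_left[symmetric] a[symmetric] by (simp add: e_def mult.commute)
    finally show ?thesis by simp
  qed
  then show ?case by blast
qed

text \<open>The weights come from expanding the polynomial \<open>\<Prod>\<^sub>t (t - x)\<close>, \<open>k < t \<le> n\<close>, in the binomial basis:
  it vanishes at \<open>k + 1, \<dots>, n\<close> but not at \<open>k\<close>, and has degree \<open>n - k\<close>.\<close>

lemma elimination_weights:
  assumes "n - k < k" "k \<le> n"
  shows "\<exists>b::nat \<Rightarrow> real. \<forall>i\<in>{k..n}. (\<Sum>s\<le>n-k. b s / fact (i - s)) = (if i = k then 1 else 0)"
proof -
  obtain a where a: "\<And>x. (\<Prod>t=1..n-k. real k + real t - x) = (\<Sum>s\<le>n-k. a s * (x gchoose s))"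
    using prod_linear_eq_sum_gbinomial[where c = "real k" and N = "n - k"] by blast
  \<comment> \<open>Division by s! turns binomials (i choose s) into i! / (i - s)!. At x = k the
    product equals (n - k)!, so k! / (n - k)! normalises the sum to 1.\<close>
  define b where "b = (\<lambda>s. fact k / fact (n - k) * (a s / fact s))"
  have "(\<Sum>s\<le>n-k. b s / fact (i - s)) = (if i = k then 1 else 0)" if i: "i \<in> {k..n}" for i
  proof -
    have "(\<Sum>s\<le>n-k. b s / fact (i - s)) = (\<Sum>s\<le>n-k. fact k / (fact (n - k) * fact i) * (a s * (real i gchoose s)))"
    proof (intro sum.cong refl)
      fix s assume "s \<in> {..n-k}"
      \<comment> \<open>By s <= n - k < k <= i the subtraction i - s is never truncated.\<close>
      then have "s \<le> i" using assms i by auto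
      then have "real i gchoose s = fact i / (fact s * fact (i - s))"
        by (simp add: binomial_gbinomial[symmetric] binomial_fact)
      then show "b s / fact (i - s) = fact k / (fact (n - k) * fact i) * (a s * (real i gchoose s))"
        by (simp add: b_def)
    qed
    also have "\<dots> = fact k / (fact (n - k) * fact i) * (\<Prod>t=1..n-k. real k + real t - real i)"
      unfolding a by (simp add: sum_distrib_left)
    also have "\<dots> = (if i = k then 1 else 0)"
    proof (cases "i = k")
      case True
      have "(\<Prod>t=1..n-k. real t) = fact (n - k)" by (simp add: fact_prod)
      then show ?thesis using True by simp
    next
      case False
      then have "(\<Prod>t=1..n-k. real k + real t - real i) = 0"
        using i by (intro prod_zero bexI[of _ "i - k"]) auto
      then show ?thesis using False by simp
    qed
    finally show ?thesis .
  qed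
  then show ?thesis by blast
qed

context interpolating_blaschke_zeros
begin

abbreviation "B \<equiv> blaschke_product z"

lemma tendsto_fin_blaschke:
  assumes "norm w < 1"
  shows "(\<lambda>N. fin_blaschke (z ` {..<N}) w) \<longlonglongrightarrow> B w"
proof -
  have "blaschke_seq z" using interpolating by (simp add: A_interpolating_blaschke_def)
  from tendsto_blaschke_product[OF this assms] show ?thesis
    using inj_z by (simp add: fin_blaschke_def prod.reindex inj_on_subset)
qed

text \<open>Here \<open>u (z j)\<close> is the derivative of \<open>B\<close> at \<open>z j\<close>.
  Up to the unit of its own factor it is a limit of partial products omitting that factor, which lie
  between the separation constant and 1 in modulus at \<open>z j\<close>; halving the constant
  accounts for 1 + |z j| < 2.\<close>

lemma blaschke_product_simple_zeros:
  "\<exists>c>0. \<forall>j. \<exists>u. u holomorphic_on ball 0 1 \<and> (\<forall>w\<in>ball 0 1. B w = (w - z j) * u w)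
     \<and> c \<le> norm (u (z j)) * (1 - norm (z j)) \<and> norm (u (z j)) * (1 - norm (z j)) \<le> 1"
proof -
  obtain c where c: "c > 0" "\<And>j S. finite S \<Longrightarrow> S \<subseteq> range z - {z j} \<Longrightarrow> c \<le> norm (fin_blaschke S (z j))"
    using uniformly_separated by blast
  have "\<exists>u. u holomorphic_on ball 0 1 \<and> (\<forall>w\<in>ball 0 1. B w = (w - z j) * u w)
     \<and> c / 2 \<le> norm (u (z j)) * (1 - norm (z j)) \<and> norm (u (z j)) * (1 - norm (z j)) \<le> 1" for j
  proof -
    define q where "q = (\<lambda>N. fin_blaschke (z ` {..<N} - {z j}))"
    have sub: "z ` {..<N} - {z j} \<subseteq> ball 0 1" for N by auto
    \<comment> \<open>For order 0 and exponent 0 the weight is 1, so this is the bare bound by 1 and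
      the compactness lemma applies.\<close>
    have "A_bound 0 0 1 (q N)" for N
      unfolding A_bound_def q_def using norm_fin_blaschke_le_1[OF sub] holomorphic_on_fin_blaschke[OF sub] by auto
    then obtain h r where h: "A_bound 0 0 1 h" "strict_mono (r :: nat \<Rightarrow> nat)"
      "\<And>s w. norm w < 1 \<Longrightarrow> (\<lambda>i. (deriv ^^ s) (q (r i)) w) \<longlonglongrightarrow> (deriv ^^ s) h w"
      by (rule A_bound_convergent_subseq) (rule that)
    have lim: "(\<lambda>i. q (r i) w) \<longlonglongrightarrow> h w" if "norm w < 1" for w using h(3)[OF that, of 0] by simp
    define u where "u = (\<lambda>w. blaschke_unit (z j) w * h w)"
    have u: "u holomorphic_on ball 0 1"
      unfolding u_def using A_boundD(1)[OF h(1)] by (intro holomorphic_intros) auto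
    have Bu: "B w = (w - z j) * u w" if w: "norm w < 1" for w
    proof -
      have "\<forall>\<^sub>F i in sequentially. fin_blaschke (z ` {..<r i}) w = blaschke_factor (z j) w * q (r i) w"
        using eventually_gt_at_top[of j]
      proof eventually_elim
        case (elim i)
        then have "j < r i" using seq_suble[OF h(2), of i] by simp
        then show ?case unfolding q_def fin_blaschke_def by (intro prod.remove) auto
      qed
      moreover have "(\<lambda>i. fin_blaschke (z ` {..<r i}) w) \<longlonglongrightarrow> B w"
        using LIMSEQ_subseq_LIMSEQ[OF tendsto_fin_blaschke[OF w] h(2)] by (simp add: o_def)
      ultimately have "(\<lambda>i. blaschke_factor (z j) w * q (r i) w) \<longlonglongrightarrow> B w"
        by (rule Lim_transform_eventually[rotated])
      moreover have "(\<lambda>i. blaschke_factor (z j) w * q (r i) w) \<longlonglongrightarrow> blaschke_factor (z j) w * h w"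
        by (intro tendsto_intros lim w)
      ultimately have "B w = blaschke_factor (z j) w * h w" by (rule LIMSEQ_unique)
      then show ?thesis by (simp add: u_def blaschke_factor_eq_unit)
    qed
    have hc: "c \<le> norm (h (z j))"
    proof (rule tendsto_lowerbound[OF tendsto_norm[OF lim[OF norm_z]]])
      show "\<forall>\<^sub>F i in sequentially. c \<le> norm (q (r i) (z j))"
        unfolding q_def by (intro always_eventually allI c) auto
    qed simp
    have h1: "norm (h (z j)) \<le> 1" using A_boundD(2)[OF h(1)] by simp
    have "norm (u (z j)) * (1 - norm (z j)) = norm (h (z j)) / (1 + norm (z j))"
    proof -
      have "1 - (norm (z j))\<^sup>2 = (1 - norm (z j)) * (1 + norm (z j))"
        by (simp add: power2_eq_square algebra_simps)
      moreover have "1 - norm (z j) \<noteq> 0" using norm_z[of j] by (simp del: norm_z)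
      ultimately show ?thesis
        by (simp add: u_def norm_mult norm_blaschke_unit_self)
    qed
    moreover have "c / 2 \<le> norm (h (z j)) / (1 + norm (z j))"
      using hc c norm_z[of j] by (intro frac_le) (auto intro: less_imp_le simp del: norm_z intro!: add_pos_nonneg)
    moreover have "norm (h (z j)) / (1 + norm (z j)) \<le> 1"
      by (subst divide_le_eq_1_pos) (auto intro: add_pos_nonneg order_trans[OF h1])
    ultimately show ?thesis using u Bu by auto
  qed
  with c show ?thesis by (intro exI[of _ "c / 2"]) auto
qed

section \<open>The two parts of the theorem\<close>

lemma upper_bound_at_zeros:
  assumes k: "real n / 2 < real k" "k \<le> n" and f: "f \<in> J_space \<alpha> B k"
  shows "\<exists>C>0. \<forall>j. norm (f (z j)) \<le> C * (sep_dist z j powr (\<alpha> - real k) * (1 - norm (z j)) ^ k)"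
proof -
  have k': "n - k < k" using k by (simp add: field_simps)
  define g where "g = (\<lambda>w. f w * B w ^ k)"
  have fh: "f holomorphic_on ball 0 1" using f by (simp add: J_space_def A_space_def)
  have "g \<in> A_space \<alpha>" using f by (simp add: J_space_def g_def)
  then obtain M where M: "A_bound (Suc n) \<alpha> M g"
    using A_space_imp_A_bound[of g \<alpha> "Suc n"] n by auto
  note D = A_boundD[OF M]
  define K where "K = (2 / (\<alpha> - real n) + 1) * M"
  have K: "K \<ge> 0" using n D(4) by (auto simp: K_def)
  obtain c where c: "c > 0" and zeros: "\<And>j. \<exists>u. u holomorphic_on ball 0 1 \<and> (\<forall>w\<in>ball 0 1. B w = (w - z j) * u w)
     \<and> c \<le> norm (u (z j)) * (1 - norm (z j)) \<and> norm (u (z j)) * (1 - norm (z j)) \<le> 1"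
    using blaschke_product_simple_zeros by blast
  \<comment> \<open>On the disc \<open>g\<close> is (w - z j)^k times f u^k, so its k-th derivative
    at \<open>z j\<close> is k! f u^k, and 1 / |u| is at most (1 - |z j|) / c there.\<close>
  have jets: "(\<forall>i<k. (deriv ^^ i) g (z j) = 0) \<and>
      fact k * norm (f (z j)) * c ^ k \<le> norm ((deriv ^^ k) g (z j)) * (1 - norm (z j)) ^ k" for j
  proof -
    obtain u where u: "u holomorphic_on ball 0 1" "\<And>w. w \<in> ball 0 1 \<Longrightarrow> B w = (w - z j) * u w"
      "c \<le> norm (u (z j)) * (1 - norm (z j))" using zeros[of j] by blast
    have fu: "(\<lambda>w. f w * u w ^ k) holomorphic_on ball 0 1" using fh u(1) by (intro holomorphic_intros)
    have eq: "(deriv ^^ i) g (z j) = (deriv ^^ i) (\<lambda>w. (w - z j) ^ k * (f w * u w ^ k)) (z j)" for i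
      using D(1) fu u(2) by (intro higher_deriv_transform_within_open[of _ "ball 0 1"])
        (auto intro!: holomorphic_intros simp: g_def power_mult_distrib)
    have "(deriv ^^ k) g (z j) = fact k * (f (z j) * u (z j) ^ k)"
      unfolding eq by (rule higher_deriv_linear_power_mult(2)[OF fu]) auto
    then have "norm ((deriv ^^ k) g (z j)) * (1 - norm (z j)) ^ k
        = fact k * norm (f (z j)) * (norm (u (z j)) * (1 - norm (z j))) ^ k"
      by (simp add: norm_mult norm_power power_mult_distrib)
    moreover have "c ^ k \<le> (norm (u (z j)) * (1 - norm (z j))) ^ k"
      using c u(3) by (intro power_mono) auto
    ultimately have "fact k * norm (f (z j)) * c ^ k \<le> norm ((deriv ^^ k) g (z j)) * (1 - norm (z j)) ^ k"
      by (simp add: mult_left_mono)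
    moreover have "(deriv ^^ i) g (z j) = 0" if "i < k" for i
      unfolding eq by (rule higher_deriv_linear_power_mult(1)[OF fu _ _ that]) auto
    ultimately show ?thesis by blast
  qed
  obtain b :: "nat \<Rightarrow> real" where b: "\<And>i. i \<in> {k..n} \<Longrightarrow> (\<Sum>s\<le>n-k. b s / fact (i - s)) = (if i = k then 1 else 0)"
    using elimination_weights[OF k' k(2)] by blast
  define L where "L = (\<Sum>s\<le>n-k. \<bar>b s\<bar>) * K"
  have L: "L \<ge> 0" using K by (auto simp: L_def intro!: mult_nonneg_nonneg sum_nonneg)
  have gk: "norm ((deriv ^^ k) g (z j)) \<le> L * 2 powr (\<alpha> - real k) * sep_dist z j powr (\<alpha> - real k)" for j
  proof -
    obtain l where l: "l \<noteq> j" "norm (z j - z l) < 2 * sep_dist z j" by (rule obtain_near_zero)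
    define h where "h = z l - z j"
    have h: "h \<noteq> 0" "norm h \<le> 2 * sep_dist z j"
      using l inj_z by (auto simp: h_def norm_minus_commute dest: injD)
    \<comment> \<open>The powers of \<open>h\<close> make the relations homogeneous: in these
      unknowns the one of order \<open>s\<close> has coefficients 1 / (i - s)!, the same for all
      \<open>j\<close>.\<close>
    define x where "x = (\<lambda>i. (deriv ^^ i) g (z j) * h ^ i)"
    have E: "norm (\<Sum>i=k..n. x i / fact (i - s)) \<le> K * norm h powr \<alpha>" if s: "s \<le> n - k" for s
    proof -
      have sk: "s < k" "s \<le> n" using s k' by auto
      have "norm ((deriv ^^ s) g (z l) - (\<Sum>m=0..n-s. (deriv ^^ (s + m)) g (z j) / fact m * (z l - z j) ^ m))
          \<le> K * norm (z l - z j) powr (\<alpha> - real s)"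
        unfolding K_def by (rule A_bound_taylor[OF n M norm_z norm_z sk(2)])
      then have "norm (\<Sum>m=0..n-s. (deriv ^^ (s + m)) g (z j) / fact m * h ^ m) \<le> K * norm h powr (\<alpha> - real s)"
        using jets[of l] sk(1) by (simp add: h_def)
      then have "norm (h ^ s) * norm (\<Sum>m=0..n-s. (deriv ^^ (s + m)) g (z j) / fact m * h ^ m)
          \<le> norm (h ^ s) * (K * norm h powr (\<alpha> - real s))"
        by (rule mult_left_mono) simp
      also have "\<dots> = K * norm h powr \<alpha>"
        using h(1) by (simp add: norm_power powr_diff powr_realpow)
      finally have "norm (h ^ s * (\<Sum>m=0..n-s. (deriv ^^ (s + m)) g (z j) / fact m * h ^ m)) \<le> K * norm h powr \<alpha>"
        by (simp only: norm_mult)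
      also have "h ^ s * (\<Sum>m=0..n-s. (deriv ^^ (s + m)) g (z j) / fact m * h ^ m)
          = (\<Sum>m=0..n-s. x (m + s) / fact (m + s - s))"
        unfolding sum_distrib_left by (intro sum.cong) (auto simp: x_def power_add add.commute)
      also have "\<dots> = (\<Sum>i=0+s..n-s+s. x i / fact (i - s))"
        by (rule sum.shift_bounds_cl_nat_ivl[symmetric])
      also have "\<dots> = (\<Sum>i=k..n. x i / fact (i - s))"
        using jets[of j] sk by (intro sum.mono_neutral_right) (auto simp: x_def)
      finally show ?thesis .
    qed
    \<comment> \<open>The weighted sum of the relations leaves only \<open>x k\<close>, so that just
      the n - k + 1 Taylor remainders have to be estimated.\<close>
    have "x k = (\<Sum>i=k..n. if i = k then x i else 0)" using k(2) by simp
    also have "\<dots> = (\<Sum>i=k..n. x i * of_real (\<Sum>s\<le>n-k. b s / fact (i - s)))"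
      by (intro sum.cong) (auto simp: b)
    also have "\<dots> = (\<Sum>i=k..n. \<Sum>s\<le>n-k. of_real (b s) * (x i / fact (i - s)))"
      by (simp add: sum_distrib_left mult.left_commute mult.commute)
    also have "\<dots> = (\<Sum>s\<le>n-k. of_real (b s) * (\<Sum>i=k..n. x i / fact (i - s)))"
      by (subst sum.swap) (simp add: sum_distrib_left)
    finally have "norm (x k) \<le> (\<Sum>s\<le>n-k. norm (of_real (b s) * (\<Sum>i=k..n. x i / fact (i - s))))"
      by (simp only: norm_sum)
    also have "\<dots> \<le> (\<Sum>s\<le>n-k. \<bar>b s\<bar> * (K * norm h powr \<alpha>))"
      unfolding norm_mult using E by (intro sum_mono mult_mono) auto
    also have "\<dots> = L * norm h powr \<alpha>" by (simp add: L_def sum_distrib_right mult.assoc)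
    finally have "norm ((deriv ^^ k) g (z j)) * norm h ^ k \<le> L * norm h powr \<alpha>"
      by (simp add: x_def norm_mult norm_power)
    then have "norm ((deriv ^^ k) g (z j)) \<le> L * norm h powr (\<alpha> - real k)"
      using h(1) by (simp add: powr_diff powr_realpow field_simps)
    also have "\<dots> \<le> L * (2 * sep_dist z j) powr (\<alpha> - real k)"
      using h(2) L n k by (intro mult_left_mono powr_mono2) auto
    also have "\<dots> = L * 2 powr (\<alpha> - real k) * sep_dist z j powr (\<alpha> - real k)"
      using sep_dist_pos[of j] by (simp add: powr_mult)
    finally show ?thesis .
  qed
  define C where "C = L * 2 powr (\<alpha> - real k) / (fact k * c ^ k)"
  \<comment> \<open>\<open>C\<close> is 0 when \<open>M\<close> is; adding 1 makes the constant
    positive.\<close>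
  have "norm (f (z j)) \<le> (C + 1) * (sep_dist z j powr (\<alpha> - real k) * (1 - norm (z j)) ^ k)" for j
  proof -
    have p: "0 \<le> (1 - norm (z j)) ^ k" using norm_z[of j] by (simp del: norm_z)
    have "fact k * norm (f (z j)) * c ^ k
        \<le> L * 2 powr (\<alpha> - real k) * sep_dist z j powr (\<alpha> - real k) * (1 - norm (z j)) ^ k"
      using jets[of j] mult_right_mono[OF gk p] by (meson order_trans)
    then have "norm (f (z j)) \<le> C * (sep_dist z j powr (\<alpha> - real k) * (1 - norm (z j)) ^ k)"
      using c by (simp add: C_def field_simps)
    also have "\<dots> \<le> (C + 1) * (sep_dist z j powr (\<alpha> - real k) * (1 - norm (z j)) ^ k)"
      using p by (intro mult_right_mono) auto
    finally show ?thesis .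
  qed
  moreover have "C \<ge> 0" using L c by (simp add: C_def)
  ultimately show ?thesis by (intro exI[of _ "C + 1"]) auto
qed

lemma sharpness_at_zeros:
  assumes k: "k \<le> n"
  shows "\<exists>f\<in>J_space \<alpha> B k. \<exists>c>0. \<exists>C>0. \<forall>j.
      c * (sep_dist z j powr (\<alpha> - real k) * (1 - norm (z j)) ^ k) \<le> norm (f (z j)) \<and>
      norm (f (z j)) \<le> C * (sep_dist z j powr (\<alpha> - real k) * (1 - norm (z j)) ^ k)"
proof -
  obtain h where h: "h \<in> A_space \<alpha>" and jets: "\<And>j s. s \<le> n \<Longrightarrow>
      (deriv ^^ s) h (z j) = (if s = k \<and> True then of_real (sep_dist z j powr (\<alpha> - real k)) else 0)"
    using obtain_interpolant[OF k, of "\<lambda>_. True"] by metis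
  obtain M where M: "A_bound (Suc n) \<alpha> M h"
    using A_space_imp_A_bound[OF h, of "Suc n"] n by auto
  note D = A_boundD[OF M]
  \<comment> \<open>The constant of the division estimate is the same for all partial products, so
    the quotients form a normal family.\<close>
  define M' where "M' = max M (8 * fact (n + 2) * ((2 / (\<alpha> - real n) + 1) * M))"
  have "\<exists>q. A_bound (n + 2) \<alpha> M' q \<and> (\<forall>w. norm w < 1 \<longrightarrow> h w = q w * fin_blaschke (z ` {..<N}) w ^ k)" for N
  proof -
    have S: "finite (z ` {..<N})" "z ` {..<N} \<subseteq> ball 0 1" by auto
    have "(deriv ^^ i) h a = 0" if "a \<in> z ` {..<N}" "i < k" for a i
      using that k jets[of i] by auto
    then obtain q where q: "q holomorphic_on ball 0 1" "\<And>w. norm w < 1 \<Longrightarrow> h w = q w * fin_blaschke (z ` {..<N}) w ^ k"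
      using holomorphic_factor_fin_blaschke[OF D(1) S, of k] by metis
    then show ?thesis unfolding M'_def using A_bound_divide_fin_blaschke[OF n M S q refl] by blast
  qed
  then have "\<forall>N. \<exists>q. A_bound (n + 2) \<alpha> M' q \<and> (\<forall>w. norm w < 1 \<longrightarrow> h w = q w * fin_blaschke (z ` {..<N}) w ^ k)"
    by (rule allI)
  from choice[OF this] obtain q where "\<forall>N. A_bound (n + 2) \<alpha> M' (q N)
      \<and> (\<forall>w. norm w < 1 \<longrightarrow> h w = q N w * fin_blaschke (z ` {..<N}) w ^ k)" by (rule exE)
  then have q: "A_bound (n + 2) \<alpha> M' (q N)" "norm w < 1 \<Longrightarrow> h w = q N w * fin_blaschke (z ` {..<N}) w ^ k" for N w
    by blast+
  obtain f r where f: "A_bound (n + 2) \<alpha> M' f" "strict_mono (r :: nat \<Rightarrow> nat)"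
    "\<And>s w. norm w < 1 \<Longrightarrow> (\<lambda>i. (deriv ^^ s) (q (r i)) w) \<longlonglongrightarrow> (deriv ^^ s) f w"
    by (rule A_bound_convergent_subseq[of "n + 2" \<alpha> M' q, OF q(1)]) (rule that)
  have hf: "h w = f w * B w ^ k" if w: "norm w < 1" for w
  proof -
    have "(\<lambda>i. q (r i) w * fin_blaschke (z ` {..<r i}) w ^ k) \<longlonglongrightarrow> f w * B w ^ k"
      using f(3)[OF w, of 0] LIMSEQ_subseq_LIMSEQ[OF tendsto_fin_blaschke[OF w] f(2)]
      by (intro tendsto_intros) (simp_all add: o_def)
    then have "(\<lambda>i. h w) \<longlonglongrightarrow> f w * B w ^ k" by (simp add: q(2)[OF w, symmetric])
    then show ?thesis by (simp add: LIMSEQ_const_iff)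
  qed
  \<comment> \<open>The division estimate has order n + 2, which is admissible because membership
    asks for some order above \<alpha>.\<close>
  have "f \<in> A_space \<alpha>" using f(1) n by (auto simp: A_space_iff_A_bound intro!: exI[of _ "n + 2"])
  moreover have "(\<lambda>w. f w * B w ^ k) \<in> A_space \<alpha>"
  proof -
    have holo: "(\<lambda>w. f w * B w ^ k) holomorphic_on ball 0 1"
      using D(1) by (rule holomorphic_transform) (simp add: hf)
    have "(deriv ^^ m) (\<lambda>w. f w * B w ^ k) w = (deriv ^^ m) h w" if "norm w < 1" for m w
      using that by (intro higher_deriv_transform_within_open[OF holo D(1)]) (auto simp: hf)
    moreover have "(\<lambda>w. f w * B w ^ k) w = h w" if "norm w < 1" for w using hf[OF that] by simp
    ultimately have "A_bound (Suc n) \<alpha> M (\<lambda>w. f w * B w ^ k)"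
      using M holo unfolding A_bound_def by (simp del: funpow.simps)
    then show ?thesis using n by (auto simp: A_space_iff_A_bound intro!: exI[of _ "Suc n"])
  qed
  ultimately have fJ: "f \<in> J_space \<alpha> B k" by (simp add: J_space_def)
  obtain c where c: "c > 0" and zeros: "\<And>j. \<exists>u. u holomorphic_on ball 0 1 \<and> (\<forall>w\<in>ball 0 1. B w = (w - z j) * u w)
     \<and> c \<le> norm (u (z j)) * (1 - norm (z j)) \<and> norm (u (z j)) * (1 - norm (z j)) \<le> 1"
    using blaschke_product_simple_zeros by blast
  have "1 / fact k * (sep_dist z j powr (\<alpha> - real k) * (1 - norm (z j)) ^ k) \<le> norm (f (z j)) \<and>
      norm (f (z j)) \<le> 1 / (fact k * c ^ k) * (sep_dist z j powr (\<alpha> - real k) * (1 - norm (z j)) ^ k)" for j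
  proof -
    obtain u where u: "u holomorphic_on ball 0 1" "\<And>w. w \<in> ball 0 1 \<Longrightarrow> B w = (w - z j) * u w"
      "c \<le> norm (u (z j)) * (1 - norm (z j))" "norm (u (z j)) * (1 - norm (z j)) \<le> 1" using zeros[of j] by blast
    have fu: "(\<lambda>w. f w * u w ^ k) holomorphic_on ball 0 1"
      using A_boundD(1)[OF f(1)] u(1) by (intro holomorphic_intros)
    have "(deriv ^^ k) h (z j) = (deriv ^^ k) (\<lambda>w. (w - z j) ^ k * (f w * u w ^ k)) (z j)"
      using D(1) fu u(2) by (intro higher_deriv_transform_within_open[of _ "ball 0 1"])
        (auto intro!: holomorphic_intros simp: hf power_mult_distrib)
    also have "\<dots> = fact k * (f (z j) * u (z j) ^ k)"
      by (rule higher_deriv_linear_power_mult(2)[OF fu]) auto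
    finally have "fact k * (f (z j) * u (z j) ^ k) = of_real (sep_dist z j powr (\<alpha> - real k))"
      using jets[OF k, of j] by simp
    then have "norm (fact k * (f (z j) * u (z j) ^ k)) = sep_dist z j powr (\<alpha> - real k)"
      by (simp only: norm_of_real) simp
    then have eq: "fact k * (norm (f (z j)) * norm (u (z j)) ^ k) = sep_dist z j powr (\<alpha> - real k)"
      by (simp add: norm_mult norm_power)
    \<comment> \<open>The target size equals k! |f (z j)| v, and v lies between c^k and 1; this
      gives both constants at once.\<close>
    define v where "v = (norm (u (z j)) * (1 - norm (z j))) ^ k"
    have eq': "sep_dist z j powr (\<alpha> - real k) * (1 - norm (z j)) ^ k = fact k * norm (f (z j)) * v"
      unfolding eq[symmetric] v_def by (simp add: power_mult_distrib)
    have v: "c ^ k \<le> v" "v \<le> 1"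
      unfolding v_def using c u(3,4) by (auto intro!: power_mono power_le_one)
    have 1: "norm (f (z j)) * v \<le> norm (f (z j))" and 2: "norm (f (z j)) * c ^ k \<le> norm (f (z j)) * v"
      using v by (auto intro: mult_left_mono mult_left_le)
    show ?thesis unfolding eq' using 1 2 c by (simp add: field_simps)
  qed
  then show ?thesis using fJ c by (intro bexI[of _ f] exI[of _ "1 / fact k"] exI[of _ "1 / (fact k * c ^ k)"] conjI) auto
qed

end

theorem theorem1p4:
  fixes n :: nat and \<alpha> :: real and z :: "nat \<Rightarrow> complex" and B :: "complex \<Rightarrow> complex"
  assumes "n \<ge> 1" and "real n < \<alpha>" and "\<alpha> < real n + 1"
    and "A_interpolating_blaschke n \<alpha> z"
    and "B = blaschke_product z"
  shows "(\<forall>k::nat. real n / 2 < real k \<and> k \<le> n \<longrightarrow>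
            (\<forall>f\<in>J_space \<alpha> B k. \<exists>C>0. \<forall>j.
               norm (f (z j)) \<le> C * (sep_dist z j powr (\<alpha> - real k) * (1 - norm (z j)) ^ k)))
       \<and> (\<forall>k\<in>{1..n}. \<exists>f\<in>J_space \<alpha> B k. \<exists>c>0. \<exists>C>0. \<forall>j.
               c * (sep_dist z j powr (\<alpha> - real k) * (1 - norm (z j)) ^ k) \<le> norm (f (z j)) \<and>
               norm (f (z j)) \<le> C * (sep_dist z j powr (\<alpha> - real k) * (1 - norm (z j)) ^ k))"
proof -
  interpret interpolating_blaschke_zeros n \<alpha> z
    using assms by unfold_locales
  show ?thesis
    unfolding assms(5) using upper_bound_at_zeros sharpness_at_zeros by auto
qed

end
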